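(* The one-cocycle $\Omega$ is exact: for every constant element $X_m\in\mathcal K_m$, $m\ge 0$, with $\Omega(X_m)=-\mathrm{Tr}\big(E\,\Theta X_m\Theta^{-1}\big)$ and flow $\delta_{X_m}\Theta=(\Theta X_m\Theta^{-1})_-\,\Theta$, $$\Omega(X_m)=-\,\delta_{X_m}\mathrm{Tr}\big(E\,\mathfrak s\big)=-\,\delta_{X_m}\mathrm{Tr}\big(E\,s^{(-1)}\big),$$ where $\Theta=US$, $S=e^{\mathfrak s}$, $\mathfrak s=\sum_{j\ge1}s^{(-j)}$.
   Context: Algebra. $\widehat{\mathcal G}$ is an affine Lie algebra, realized by matrices depending on a loop parameter $\lambda$ (no central extension), with an integral gradation $\widehat{\mathcal G}=\bigoplus_{n\in\mathbb Z}\widehat{\mathcal G}_n$ given by a grading operator $Q_{\mathbf s}$: $[Q_{\mathbf s},Y]=nY$ for $Y\in\widehat{\mathcal G}_n$. Infinite sums over descending negative grades are allowed. For $Y=\sum_n Y_n$, $Y_n$ of grade $n$, put $(Y)_-=\sum_{n<0}Y_n$. $E\in\widehat{\mathcal G}_1$ is a constant semisimple element, so $\widehat{\mathcal G}=\mathcal K\oplus\mathcal M$ with $\mathcal K=\mathrm{Ker}(\mathrm{ad}\,E)$, $\mathcal M=\mathrm{Im}(\mathrm{ad}\,E)$; $\mathcal K_n=\mathcal K\cap\widehat{\mathcal G}_n$, $\mathcal M_n=\mathcal M\cap\widehat{\mathcal G}_n$. "Constant" means independent of $x$ and of all flow parameters. Trace. $\mathrm{Tr}(Y)=\mathrm{tr}\,(Y)_0$: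 projection on the grade-zero component followed by the ordinary matrix trace; it is cyclic. Dressing. $L=D_x+E+A$, with $D_x$ differentiation $\partial_x$ and $A=A(x)\in\mathcal M_0$. The dressing operator is $\Theta=US$ with $U=\exp\big(\sum_{j\ge1}u^{(-j)}\big)$, $u^{(-j)}\in\mathcal M_{-j}$, and $S=\exp(\mathfrak s)$, $\mathfrak s=\sum_{j\ge1}s^{(-j)}$, $s^{(-j)}\in\mathcal K_{-j}$, such that $U^{-1}LU=D_x+E+K^-$ with $K^-$ in the negative-grade part of $\mathcal K$, and $\Theta^{-1}(D_x+E+A)\Theta=D_x+E$. Each $\delta_X$ acts as a derivation (Leibniz rule) vanishing on constant elements; its action on $U$, $S$, $u^{(-j)}$, $s^{(-j)}$ is the one induced from its action on $\Theta=US$ (so $\delta_Xu^{(-j)}\in\mathcal M_{-j}$, $\delta_Xs^{(-j)}\in\mathcal K_{-j}$). Exactness of $\Omega$ means that $\Omega(X)=\delta_X\Omega_0$ for some function $\Omega_0$ independent of $X$. *)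

theory Defs
  imports "HOL-Analysis.Analysis" "HOL-Computational_Algebra.Formal_Laurent_Series"
begin

text \<open>
  The loop parameter is \<open>\<lambda> = X\<inverse>\<close>, where \<open>X\<close> is the variable of the library's formal
  Laurent series: an element of \<open>'a fls\<close> is a series in \<open>\<lambda>\<close> whose exponents are bounded above.
  The coefficient ring \<open>'a\<close> is \<open>complex\<close> for constant elements, and a commutative
  ring \<open>'f\<close> of functions of \<open>x\<close> and of the flow parameters, which contains the
  complex constants through a ring homomorphism \<open>\<iota>\<close>, for the elements that depend on them.
  On matrices, \<open>**\<close> is the matrix product; the library's \<open>*\<close> on \<open>vec\<close> is componentwise.
\<close>

type_synonym ('a, 'n) loop_mat = "'a fls ^ 'n ^ 'n"

definition lcoeff :: "('a::zero, 'n) loop_mat \<Rightarrow> int \<Rightarrow> 'a ^ 'n ^ 'n" where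
  \<comment> \<open>coefficient of \<open>\<lambda>\<^sup>k\<close>\<close>
  "lcoeff Y k = map_matrix (\<lambda>f. fls_nth f (- k)) Y"

definition fls_map :: "('a::zero \<Rightarrow> 'b::zero) \<Rightarrow> 'a fls \<Rightarrow> 'b fls" where
  "fls_map h f = Abs_fls (\<lambda>k. h (fls_nth f k))"

definition mcomm :: "'a::comm_ring_1 ^ 'n ^ 'n \<Rightarrow> 'a ^ 'n ^ 'n \<Rightarrow> 'a ^ 'n ^ 'n" where
  "mcomm A B = A ** B - B ** A"

definition smul :: "'a::comm_ring_1 \<Rightarrow> 'a ^ 'n ^ 'n \<Rightarrow> 'a ^ 'n ^ 'n" where
  "smul c A = map_matrix (\<lambda>a. c * a) A"

definition mpow :: "'a::comm_ring_1 ^ 'n ^ 'n \<Rightarrow> nat \<Rightarrow> 'a ^ 'n ^ 'n" where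
  "mpow A k = ((\<lambda>B. A ** B) ^^ k) (mat 1)"

text \<open>Infinite sums are taken coefficientwise, each coefficient being a finite sum.\<close>

definition has_formal_sum ::
  "('i \<Rightarrow> ('a::comm_ring_1, 'n::finite) loop_mat) \<Rightarrow> 'i set \<Rightarrow> ('a, 'n) loop_mat \<Rightarrow> bool" where
  "has_formal_sum y I Y \<longleftrightarrow>
     (\<forall>k. finite {i \<in> I. lcoeff (y i) k \<noteq> 0} \<and>
          lcoeff Y k = (\<Sum>i \<in> {i \<in> I. lcoeff (y i) k \<noteq> 0}. lcoeff (y i) k))"

definition formal_sum :: "('i \<Rightarrow> ('a::comm_ring_1, 'n::finite) loop_mat) \<Rightarrow> 'i set \<Rightarrow> ('a, 'n) loop_mat" where
  "formal_sum y I = (THE Y. has_formal_sum y I Y)"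

definition lie_subalgebra :: "(complex ^ 'n ^ 'n) set \<Rightarrow> bool" where
  "lie_subalgebra g \<longleftrightarrow> 0 \<in> g \<and> (\<forall>a\<in>g. \<forall>b\<in>g. a + b \<in> g \<and> mcomm a b \<in> g) \<and>
     (\<forall>c. \<forall>a\<in>g. smul c a \<in> g)"

definition lie_ideal :: "(complex ^ 'n ^ 'n) set \<Rightarrow> (complex ^ 'n ^ 'n) set \<Rightarrow> bool" where
  "lie_ideal J g \<longleftrightarrow> J \<subseteq> g \<and> lie_subalgebra J \<and> (\<forall>a\<in>g. \<forall>b\<in>J. mcomm a b \<in> J)"

definition simple_lie_algebra :: "(complex ^ 'n ^ 'n) set \<Rightarrow> bool" where
  "simple_lie_algebra g \<longleftrightarrow> lie_subalgebra g \<and> (\<exists>a\<in>g. \<exists>b\<in>g. mcomm a b \<noteq> 0) \<and>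
     (\<forall>J. lie_ideal J g \<longrightarrow> J = {0} \<or> J = g)"

definition lie_automorphism ::
  "(complex ^ 'n ^ 'n) set \<Rightarrow> (complex ^ 'n ^ 'n \<Rightarrow> complex ^ 'n ^ 'n) \<Rightarrow> bool" where
  "lie_automorphism g \<sigma> \<longleftrightarrow> bij_betw \<sigma> g g \<and>
     (\<forall>a\<in>g. \<forall>b\<in>g. \<sigma> (a + b) = \<sigma> a + \<sigma> b \<and> \<sigma> (mcomm a b) = mcomm (\<sigma> a) (\<sigma> b)) \<and>
     (\<forall>c. \<forall>a\<in>g. \<sigma> (smul c a) = smul c (\<sigma> a))"

text \<open>
  The (twisted) loop algebra of Laurent polynomials \<open>Y\<close> in \<open>\<lambda>\<close> with values in \<open>g\<close> such
  that \<open>\<sigma> (Y(\<lambda>)) = Y(exp(2\<pi>\<i>/r) \<lambda>)\<close>; the identity with \<open>r = 1\<close> is the untwisted case.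
\<close>

definition loop_algebra ::
  "(complex ^ 'n ^ 'n) set \<Rightarrow> (complex ^ 'n ^ 'n \<Rightarrow> complex ^ 'n ^ 'n) \<Rightarrow> nat \<Rightarrow>
   (complex, 'n) loop_mat set" where
  "loop_algebra g \<sigma> r = {Y. finite {k. lcoeff Y k \<noteq> 0} \<and>
     (\<forall>k. lcoeff Y k \<in> g \<and>
          \<sigma> (lcoeff Y k) = smul (cis (2 * pi * of_int k / of_nat r)) (lcoeff Y k))}"

definition affine_lie_algebra :: "(complex, 'n::finite) loop_mat set \<Rightarrow> bool" where
  "affine_lie_algebra G \<longleftrightarrow> (\<exists>g \<sigma> r. simple_lie_algebra g \<and> lie_automorphism g \<sigma> \<and>
     r > 0 \<and> (\<forall>a\<in>g. (\<sigma> ^^ r) a = a) \<and> G = loop_algebra g \<sigma> r)"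

text \<open>
  A pair \<open>(c, H)\<close> with \<open>c > 0\<close> encodes the grading operator \<open>Q = c \<lambda> d/d\<lambda> + H\<close>. The
  factor \<open>c\<close> need not be an integer, since \<open>\<lambda>\<close> itself may have fractional grade in a
  twisted realization. Note \<open>\<lambda> d/d\<lambda> = - X d/dX\<close>.
\<close>

type_synonym 'n grading_op = "real \<times> (complex ^ 'n ^ 'n)"

definition ad_grading ::
  "(complex \<Rightarrow> 'a::comm_ring_1) \<Rightarrow> 'n::finite grading_op \<Rightarrow> ('a, 'n) loop_mat \<Rightarrow> ('a, 'n) loop_mat" where
  \<comment> \<open>\<open>[Q, Y]\<close>\<close>
  "ad_grading \<iota> Q Y =
     smul (fls_const (\<iota> (of_real (fst Q)))) (map_matrix (\<lambda>f. - (fls_X * fls_deriv f)) Y)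
     + mcomm (map_matrix (\<lambda>z. fls_const (\<iota> z)) (snd Q)) Y"

definition homogeneous ::
  "(complex \<Rightarrow> 'a::comm_ring_1) \<Rightarrow> 'n::finite grading_op \<Rightarrow> int \<Rightarrow> ('a, 'n) loop_mat \<Rightarrow> bool" where
  "homogeneous \<iota> Q n Y \<longleftrightarrow> ad_grading \<iota> Q Y = smul (of_int n) Y"

definition grade_expansion ::
  "(complex \<Rightarrow> 'a::comm_ring_1) \<Rightarrow> 'n::finite grading_op \<Rightarrow>
   ('a, 'n) loop_mat \<Rightarrow> (int \<Rightarrow> ('a, 'n) loop_mat) \<Rightarrow> bool" where
  "grade_expansion \<iota> Q Y y \<longleftrightarrow> (\<forall>n. homogeneous \<iota> Q n (y n)) \<and> (\<exists>N. \<forall>n>N. y n = 0) \<and>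
     has_formal_sum y UNIV Y"

definition grade_part ::
  "(complex \<Rightarrow> 'a::comm_ring_1) \<Rightarrow> 'n::finite grading_op \<Rightarrow>
   ('a, 'n) loop_mat \<Rightarrow> int \<Rightarrow> ('a, 'n) loop_mat" where
  "grade_part \<iota> Q Y = (THE y. grade_expansion \<iota> Q Y y)"

definition neg_part ::
  "(complex \<Rightarrow> 'a::comm_ring_1) \<Rightarrow> 'n::finite grading_op \<Rightarrow> ('a, 'n) loop_mat \<Rightarrow> ('a, 'n) loop_mat" where
  "neg_part \<iota> Q Y = formal_sum (grade_part \<iota> Q Y) {..<0}"

text \<open>
  The matrix trace of a grade-zero element does not depend on \<open>\<lambda>\<close>, because
  \<open>c \<lambda> d/d\<lambda>\<close> annihilates it; it is identified with its \<open>\<lambda>\<^sup>0\<close> coefficient, a function.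
\<close>

definition Tr ::
  "(complex \<Rightarrow> 'a::comm_ring_1) \<Rightarrow> 'n::finite grading_op \<Rightarrow> ('a, 'n) loop_mat \<Rightarrow> 'a" where
  "Tr \<iota> Q Y = fls_nth (trace (grade_part \<iota> Q Y 0)) 0"

definition grade_space :: "'n::finite grading_op \<Rightarrow> (complex, 'n) loop_mat set \<Rightarrow> int \<Rightarrow> (complex, 'n) loop_mat set" where
  "grade_space Q G n = {Y \<in> G. homogeneous id Q n Y}"

text \<open>Directness of the sum is automatic, the summands being eigenspaces.\<close>

definition integral_gradation :: "'n::finite grading_op \<Rightarrow> (complex, 'n) loop_mat set \<Rightarrow> bool" where
  "integral_gradation Q G \<longleftrightarrow> fst Q > 0 \<and>
     (\<forall>Y\<in>G. \<exists>y. (\<forall>n. y n \<in> grade_space Q G n) \<and> finite {n. y n \<noteq> 0} \<and>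
        Y = (\<Sum>n \<in> {n. y n \<noteq> 0}. y n))"

definition eval_loop :: "(complex, 'n) loop_mat \<Rightarrow> complex \<Rightarrow> complex ^ 'n ^ 'n" where
  "eval_loop Y z = (\<Sum>k \<in> {k. lcoeff Y k \<noteq> 0}. smul (z powi k) (lcoeff Y k))"

definition diagonalizable :: "complex ^ 'n ^ 'n \<Rightarrow> bool" where
  "diagonalizable A \<longleftrightarrow>
     (\<exists>P :: complex ^ 'n ^ 'n. invertible P \<and> (\<forall>i j. i \<noteq> j \<longrightarrow> (matrix_inv P ** A ** P) $ i $ j = 0))"

definition semisimple_loop :: "(complex, 'n::finite) loop_mat \<Rightarrow> bool" where
  "semisimple_loop E \<longleftrightarrow> (\<forall>z. z \<noteq> 0 \<longrightarrow> diagonalizable (eval_loop E z))"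

definition ad_ker :: "(complex, 'n::finite) loop_mat set \<Rightarrow> (complex, 'n) loop_mat \<Rightarrow> (complex, 'n) loop_mat set" where
  "ad_ker G E = {Y \<in> G. mcomm E Y = 0}"

definition ad_im :: "(complex, 'n::finite) loop_mat set \<Rightarrow> (complex, 'n) loop_mat \<Rightarrow> (complex, 'n) loop_mat set" where
  "ad_im G E = mcomm E ` G"

definition K_space ::
  "'n::finite grading_op \<Rightarrow> (complex, 'n) loop_mat set \<Rightarrow> (complex, 'n) loop_mat \<Rightarrow> int \<Rightarrow>
   (complex, 'n) loop_mat set" where
  "K_space Q G E n = ad_ker G E \<inter> grade_space Q G n"

definition M_space ::
  "'n::finite grading_op \<Rightarrow> (complex, 'n) loop_mat set \<Rightarrow> (complex, 'n) loop_mat \<Rightarrow> int \<Rightarrow>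
   (complex, 'n) loop_mat set" where
  "M_space Q G E n = ad_im G E \<inter> grade_space Q G n"

text \<open>
  The sum is direct, and it holds for every semisimple homogeneous \<open>E\<close>.
\<close>

definition ker_im_decomposition :: "(complex, 'n::finite) loop_mat set \<Rightarrow> (complex, 'n) loop_mat \<Rightarrow> bool" where
  "ker_im_decomposition G E \<longleftrightarrow> ad_ker G E \<inter> ad_im G E = {0} \<and> (\<forall>Y\<in>G. \<exists>a\<in>ad_ker G E. \<exists>b\<in>ad_im G E. Y = a + b)"

definition constants_embedding :: "(complex \<Rightarrow> 'f::comm_ring_1) \<Rightarrow> bool" where
  "constants_embedding \<iota> \<longleftrightarrow> \<iota> 1 = 1 \<and> (\<forall>a b. \<iota> (a + b) = \<iota> a + \<iota> b) \<and> (\<forall>a b. \<iota> (a * b) = \<iota> a * \<iota> b)"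

definition derivation :: "(complex \<Rightarrow> 'f::comm_ring_1) \<Rightarrow> ('f \<Rightarrow> 'f) \<Rightarrow> bool" where
  "derivation \<iota> d \<longleftrightarrow> (\<forall>a b. d (a + b) = d a + d b) \<and>
     (\<forall>a b. d (a * b) = d a * b + a * d b) \<and> (\<forall>z. d (\<iota> z) = 0)"

definition mderiv :: "('f::comm_ring_1 \<Rightarrow> 'f) \<Rightarrow> ('f, 'n::finite) loop_mat \<Rightarrow> ('f, 'n) loop_mat" where
  "mderiv d Y = map_matrix (fls_map d) Y"

definition cemb :: "(complex \<Rightarrow> 'f::comm_ring_1) \<Rightarrow> (complex, 'n::finite) loop_mat \<Rightarrow> ('f, 'n) loop_mat" where
  "cemb \<iota> Y = map_matrix (fls_map \<iota>) Y"

text \<open>The elements of \<open>V\<close> with function coefficients, i.e. \<open>'f \<otimes> V\<close>.\<close>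

definition fun_span :: "(complex \<Rightarrow> 'f::comm_ring_1) \<Rightarrow> (complex, 'n::finite) loop_mat set \<Rightarrow> ('f, 'n) loop_mat set" where
  "fun_span \<iota> V = {(\<Sum>v\<in>T. smul (fls_const (f v)) (cemb \<iota> v)) | T f. finite T \<and> T \<subseteq> V}"

definition mexp :: "(complex \<Rightarrow> 'f::comm_ring_1) \<Rightarrow> ('f, 'n::finite) loop_mat \<Rightarrow> ('f, 'n) loop_mat" where
  "mexp \<iota> W = formal_sum (\<lambda>k. smul (fls_const (\<iota> (1 / fact k))) (mpow W k)) UNIV"

text \<open>The operator \<open>D\<^sub>x + B\<close>, and conjugation \<open>\<Theta>\<inverse> L \<Theta>\<close> as a composition of operators.\<close>

definition lax_op :: "('f::comm_ring_1 \<Rightarrow> 'f) \<Rightarrow> ('f, 'n::finite) loop_mat \<Rightarrow> ('f, 'n) loop_mat \<Rightarrow> ('f, 'n) loop_mat" where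
  "lax_op dx B \<Psi> = mderiv dx \<Psi> + B ** \<Psi>"

definition dress ::
  "('f::comm_ring_1, 'n::finite) loop_mat \<Rightarrow> (('f, 'n) loop_mat \<Rightarrow> ('f, 'n) loop_mat) \<Rightarrow>
   ('f, 'n) loop_mat \<Rightarrow> ('f, 'n) loop_mat" where
  "dress \<Theta> L = (\<lambda>\<Psi>. matrix_inv \<Theta> ** L (\<Theta> ** \<Psi>))"

definition Omega ::
  "(complex \<Rightarrow> 'f::comm_ring_1) \<Rightarrow> 'n::finite grading_op \<Rightarrow> (complex, 'n) loop_mat \<Rightarrow>
   ('f, 'n) loop_mat \<Rightarrow> (complex, 'n) loop_mat \<Rightarrow> 'f" where
  "Omega \<iota> Q E \<Theta> X = - Tr \<iota> Q (cemb \<iota> E ** (\<Theta> ** cemb \<iota> X ** matrix_inv \<Theta>))"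

definition exact_cocycle :: "'x set \<Rightarrow> ('x \<Rightarrow> 'f \<Rightarrow> 'f) \<Rightarrow> ('x \<Rightarrow> 'f) \<Rightarrow> bool" where
  "exact_cocycle C \<delta> \<omega> \<longleftrightarrow> (\<exists>\<omega>0. \<forall>X\<in>C. \<omega> X = \<delta> X \<omega>0)"

end

theory Submission
  imports Defs
begin

text \<open>
  The component of \<open>\<Theta>\<close> of grade \<open>-1\<close> is \<open>u\<^sub>1 + s\<^sub>1\<close>, so the component of grade \<open>-1\<close> of the flow
  equation reads \<open>\<delta> (u\<^sub>1 + s\<^sub>1) = (\<Theta> X \<Theta>\<inverse>)\<^sub>-\<^sub>1\<close>. As \<open>E\<close> has grade \<open>1\<close>, pairing with \<open>E\<close> under the
  trace sees only this component, and \<open>tr (E u\<^sub>1) = 0\<close> because \<open>u\<^sub>1\<close> is in the image of \<open>ad E\<close>.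
  The grades make sense over the function ring because \<open>ad H\<close>, where \<open>Q = c \<lambda> d/d\<lambda> + H\<close>, has bounded
  spectrum: the powers of \<open>\<lambda>\<close> that occur in grade \<open>n\<close> stay within
  bounded distance of \<open>n / c\<close>.
\<close>

section \<open>Matrices over commutative rings\<close>

text \<open>The matrix \<open>H\<close> is an arbitrary complex matrix, so a homogeneous element may
  spread over several powers of lambda and one power may carry several grades. The proof therefore
  keeps two filtrations, by grade and by order in lambda, and compares them in both directions. The
  coefficient ring may have zero divisors; linear algebra over it succeeds because the scalars to be
  cancelled are images of nonzero complex numbers. The flow equation is compared modulo grade at
  most -2: to this accuracy exponentials and their products are linear in their leading terms, since
  every correction contains a product of two factors of grade at most -1.\<close>

lemma matrix_add_rdist: "(A + B) ** C = A ** C + (B ** C :: 'a::semiring_1 ^ 'p ^ 'n)"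
  by (simp add: vec_eq_iff matrix_matrix_mult_def distrib_right sum.distrib)

lemma matrix_diff_ldist: "A ** (B - C) = A ** B - (A ** C :: 'a::ring_1 ^ 'p ^ 'n)"
  by (simp add: vec_eq_iff matrix_matrix_mult_def right_diff_distrib sum_subtractf)

lemma matrix_diff_rdist: "(A - B) ** C = A ** C - (B ** C :: 'a::ring_1 ^ 'p ^ 'n)"
  by (simp add: vec_eq_iff matrix_matrix_mult_def left_diff_distrib sum_subtractf)

lemmas matrix_dists = matrix_add_ldistrib matrix_add_rdist matrix_diff_ldist matrix_diff_rdist

lemma matrix_sum_ldist: "C ** (\<Sum>i\<in>I. f i) = (\<Sum>i\<in>I. C ** (f i :: 'a::semiring_1 ^ 'p ^ 'n))"
  by (induction I rule: infinite_finite_induct) (simp_all add: matrix_add_ldistrib)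

lemma smul_nth [simp]: "smul c A $ i $ j = c * A $ i $ j"
  by (simp add: smul_def)

lemma smul_0 [simp]: "smul c 0 = 0" "smul 0 A = 0"
  by (simp_all add: vec_eq_iff)

lemma smul_1 [simp]: "smul 1 A = A"
  by (simp add: vec_eq_iff)

lemma smul_smul: "smul a (smul b A) = smul (a * b) A"
  by (simp add: vec_eq_iff mult.assoc)

lemma smul_add_left: "smul (a + b) A = smul a A + smul b A"
  by (simp add: vec_eq_iff distrib_right)

lemma smul_diff_left: "smul (a - b) A = smul a A - smul b A"
  by (simp add: vec_eq_iff left_diff_distrib)

lemma smul_add: "smul c (A + B) = smul c A + smul c B"
  by (simp add: vec_eq_iff distrib_left)

lemma smul_diff: "smul c (A - B) = smul c A - smul c B"
  by (simp add: vec_eq_iff right_diff_distrib)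

lemma smul_sum: "smul c (sum f I) = (\<Sum>i\<in>I. smul c (f i))"
  by (induction I rule: infinite_finite_induct) (simp_all add: smul_add)

lemma smul_mult_left: "smul c A ** B = smul c (A ** B)"
  by (simp add: vec_eq_iff matrix_matrix_mult_def sum_distrib_left mult.assoc)

lemma smul_mult_right: "A ** smul c B = smul c (A ** B)"
  by (simp add: vec_eq_iff matrix_matrix_mult_def sum_distrib_left mult_ac)

lemma trace_smul: "trace (smul c A) = c * trace A"
  by (simp add: trace_def sum_distrib_left)

lemma trace_sum: "trace (sum f I) = (\<Sum>i\<in>I. trace (f i :: 'a::comm_semiring_1^'n^'n))"
  by (simp add: trace_def) (rule sum.swap)

lemma mcomm_0 [simp]: "mcomm A 0 = 0"
  by (simp add: mcomm_def)

lemma mcomm_add: "mcomm A (B + C) = mcomm A B + mcomm A C"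
  by (simp add: mcomm_def matrix_dists)

lemma mcomm_sum: "mcomm A (sum f I) = (\<Sum>i\<in>I. mcomm A (f i))"
  by (induction I rule: infinite_finite_induct) (simp_all add: mcomm_add)

lemma mcomm_smul: "mcomm A (smul c B) = smul c (mcomm A B)"
  by (simp add: mcomm_def smul_mult_left smul_mult_right smul_diff)

lemma mcomm_mult: "mcomm A (B ** C) = mcomm A B ** C + B ** mcomm A C"
  by (simp add: mcomm_def matrix_dists matrix_mul_assoc)

lemma trace_mult_mcomm: "trace (A ** mcomm A B) = 0"
proof -
  have "trace (A ** (A ** B)) = trace (A ** (B ** A))"
    using trace_mul_sym[of A "A ** B"] by (simp add: matrix_mul_assoc)
  then show ?thesis
    by (simp add: mcomm_def matrix_dists trace_sub)
qed

text \<open>\<open>matrix_inv\<close> is a choice operator, so its value is known only through an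
  explicit two-sided inverse; for the dressing operator this is a Neumann series.\<close>

lemma matrix_inv_unique:
  fixes A :: "'a::semiring_1^'n^'n"
  assumes "A ** B = mat 1" "B ** A = mat 1"
  shows "matrix_inv A = B"
proof -
  have "\<exists>A'. A ** A' = mat 1 \<and> A' ** A = mat 1"
    using assms by blast
  then have "A ** matrix_inv A = mat 1"
    unfolding matrix_inv_def by (rule someI2_ex) blast
  then show ?thesis
    using assms(2) by (metis matrix_mul_assoc matrix_mul_lid matrix_mul_rid)
qed

section \<open>Coefficients of loop matrices\<close>

lemma lcoeff_nth [simp]: "lcoeff Y k $ i $ j = fls_nth (Y $ i $ j) (- k)"
  by (simp add: lcoeff_def)

lemma lcoeff_0 [simp]: "lcoeff 0 k = 0"
  by (simp add: vec_eq_iff)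

lemma lcoeff_add: "lcoeff (A + B) k = lcoeff A k + lcoeff (B :: ('a::comm_ring_1, 'n::finite) loop_mat) k"
  by (simp add: vec_eq_iff)

lemma lcoeff_diff: "lcoeff (A - B) k = lcoeff A k - lcoeff (B :: ('a::comm_ring_1, 'n::finite) loop_mat) k"
  by (simp add: vec_eq_iff)

lemma lcoeff_sum: "lcoeff (sum f I) k = (\<Sum>i\<in>I. lcoeff (f i :: ('a::comm_ring_1, 'n::finite) loop_mat) k)"
  by (induction I rule: infinite_finite_induct) (simp_all add: lcoeff_add)

lemma lcoeff_smul_const [simp]: "lcoeff (smul (fls_const a) Y) k = smul a (lcoeff Y k)"
  by (simp add: vec_eq_iff)

lemma lcoeff_eqI: "(\<And>k. lcoeff A k = lcoeff B k) \<Longrightarrow> A = B"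
  by (simp add: vec_eq_iff fls_eq_iff) (metis minus_minus)

lemma lcoeff_surj:
  fixes c :: "int \<Rightarrow> 'a::zero ^ 'n ^ 'n"
  assumes "\<And>k. k > d \<Longrightarrow> c k = 0"
  obtains Y where "\<And>k. lcoeff Y k = c k"
proof
  fix k
  have "fls_nth (Abs_fls (\<lambda>m. c (- m) $ i $ j)) (- k) = c k $ i $ j" for i j
    by (subst nth_Abs_fls_lower_bound[of "-d"]) (simp_all add: assms)
  then show "lcoeff (\<chi> i j. Abs_fls (\<lambda>m. c (- m) $ i $ j)) k = c k"
    by (simp add: vec_eq_iff)
qed

text \<open>Lambda is the inverse of the series variable, so each series has a highest power of
  lambda. These sets are the balls around 0 of the resulting topology: the smaller \<open>d\<close>,
  the closer to 0.\<close>

definition lbounded :: "int \<Rightarrow> ('a::zero, 'n::finite) loop_mat \<Rightarrow> bool" where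
  "lbounded d Y \<longleftrightarrow> (\<forall>k>d. lcoeff Y k = 0)"

lemma lbounded_mono: "lbounded d Y \<Longrightarrow> d \<le> e \<Longrightarrow> lbounded e Y"
  by (simp add: lbounded_def)

lemma lbounded_0 [simp]: "lbounded d 0"
  by (simp add: lbounded_def)

lemma lbounded_add: "lbounded d A \<Longrightarrow> lbounded d B \<Longrightarrow> lbounded d (A + B)"
  for A :: "('a::comm_ring_1, 'n::finite) loop_mat"
  by (simp add: lbounded_def lcoeff_add)

lemma lbounded_smul: "lbounded d Y \<Longrightarrow> lbounded d (smul (fls_const a) Y)"
  by (simp add: lbounded_def)

lemma lbounded_exists: "\<exists>d. lbounded d Y"
  for Y :: "('a::zero, 'n::finite) loop_mat"
proof
  let ?D = "(\<lambda>(i, j). - fls_subdegree (Y $ i $ j)) ` UNIV"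
  have "- fls_subdegree (Y $ i $ j) \<le> Max ?D" for i j
    by (rule Max_ge) (auto intro!: rev_image_eqI[of "(i, j)"])
  then have "fls_nth (Y $ i $ j) (- k) = 0" if "k > Max ?D" for k i j
    using that by (smt (verit) fls_eq0_below_subdegree)
  then show "lbounded (Max ?D) Y"
    by (simp add: lbounded_def vec_eq_iff)
qed

lemma lbounded_all_imp_0: "(\<And>d. lbounded d Y) \<Longrightarrow> Y = 0"
  by (rule lcoeff_eqI) (metis lbounded_def lcoeff_0 lt_ex)

text \<open>Arbitrary lower bounds replace the exact subdegrees because a coefficientwise map can
  raise the subdegree, and several products must then be compared over one index range.\<close>

lemma fls_times_nth_interval:
  fixes f g :: "'a::comm_ring_1 fls"
  assumes "\<And>k. k < a \<Longrightarrow> fls_nth f k = 0" "\<And>k. k < b \<Longrightarrow> fls_nth g k = 0"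
  shows "fls_nth (f * g) n = (\<Sum>i=a..n-b. fls_nth f i * fls_nth g (n - i))"
proof -
  have "fls_nth (f * g) n = (\<Sum>i=fls_subdegree f..n - fls_subdegree g. fls_nth f i * fls_nth g (n - i))"
    unfolding fls_times_nth
    by (rule sum.reindex_bij_witness[of _ "\<lambda>i. i + fls_subdegree g" "\<lambda>i. i - fls_subdegree g"])
       (auto simp: algebra_simps)
  also have "\<dots> = (\<Sum>i=min a (fls_subdegree f)..n-min b (fls_subdegree g). fls_nth f i * fls_nth g (n - i))"
  proof (rule sum.mono_neutral_left)
    show "\<forall>i\<in>{min a (fls_subdegree f)..n-min b (fls_subdegree g)} - {fls_subdegree f..n - fls_subdegree g}.
        fls_nth f i * fls_nth g (n - i) = 0"
    proof
      fix i assume "i \<in> {min a (fls_subdegree f)..n-min b (fls_subdegree g)} - {fls_subdegree f..n - fls_subdegree g}"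
      then have "i < fls_subdegree f \<or> n - i < fls_subdegree g" by auto
      then show "fls_nth f i * fls_nth g (n - i) = 0" by auto
    qed
  qed auto
  also have "\<dots> = (\<Sum>i=a..n-b. fls_nth f i * fls_nth g (n - i))"
  proof (rule sum.mono_neutral_right)
    show "\<forall>i\<in>{min a (fls_subdegree f)..n-min b (fls_subdegree g)} - {a..n-b}.
        fls_nth f i * fls_nth g (n - i) = 0"
    proof
      fix i assume "i \<in> {min a (fls_subdegree f)..n-min b (fls_subdegree g)} - {a..n-b}"
      then have "i < a \<or> n - i < b" by auto
      then show "fls_nth f i * fls_nth g (n - i) = 0" using assms by auto
    qed
  qed auto
  finally show ?thesis .
qed

lemma lbounded_mult:
  fixes A B :: "('a::comm_ring_1, 'n::finite) loop_mat"
  assumes "lbounded d A" "lbounded e B"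
  shows "lbounded (d + e) (A ** B)"
proof -
  have "fls_nth (A $ i $ l * B $ l $ j) (- k) = 0" if "k > d + e" for i j l k
  proof -
    have "fls_nth (A $ i $ l) m = 0" if "m < - d" for m
      using assms(1) that unfolding lbounded_def vec_eq_iff
      by (metis add.inverse_inverse lcoeff_nth neg_less_iff_less zero_index)
    moreover have "fls_nth (B $ l $ j) m = 0" if "m < - e" for m
      using assms(2) that unfolding lbounded_def vec_eq_iff
      by (metis add.inverse_inverse lcoeff_nth neg_less_iff_less zero_index)
    ultimately show ?thesis
      using that by (subst fls_times_nth_interval[of "-d" _ "-e"]) auto
  qed
  then show ?thesis
    by (simp add: lbounded_def vec_eq_iff matrix_matrix_mult_def fls_nth_sum)
qed

section \<open>Coefficientwise maps of Laurent series: homomorphisms and derivations\<close>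

lemma fls_map_nth [simp]: "h 0 = 0 \<Longrightarrow> fls_nth (fls_map h f) k = h (fls_nth f k)"
  unfolding fls_map_def by (rule nth_Abs_fls_lower_bound[of "fls_subdegree f"]) simp

lemma fls_map_mult:
  fixes f g :: "'a::comm_ring_1 fls" and h :: "'a \<Rightarrow> 'b::comm_ring_1"
  assumes "\<And>a b. h (a + b) = h a + h b" "\<And>a b. h (a * b) = h a * h b"
  shows "fls_map h (f * g) = fls_map h f * fls_map h g"
proof (rule fls_eqI)
  fix n
  have h0: "h 0 = 0"
    using assms(1)[of 0 0] by simp
  have hsum: "h (\<Sum>i\<in>I. x i) = (\<Sum>i\<in>I. h (x i))" for x :: "int \<Rightarrow> 'a" and I
    by (induction I rule: infinite_finite_induct) (simp_all add: h0 assms)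
  have 1: "fls_nth (f * g) n = (\<Sum>i=fls_subdegree f..n-fls_subdegree g. fls_nth f i * fls_nth g (n - i))"
    by (rule fls_times_nth_interval) auto
  have 2: "fls_nth (fls_map h f * fls_map h g) n
     = (\<Sum>i=fls_subdegree f..n-fls_subdegree g. fls_nth (fls_map h f) i * fls_nth (fls_map h g) (n - i))"
    by (rule fls_times_nth_interval) (auto simp: h0)
  show "fls_nth (fls_map h (f * g)) n = fls_nth (fls_map h f * fls_map h g) n"
    unfolding 2 using 1 by (simp add: h0 hsum assms(2))
qed

lemma fls_map_derivation:
  fixes f g :: "'a::comm_ring_1 fls"
  assumes "\<And>a b. h (a + b) = h a + h b" "\<And>a b. h (a * b) = h a * b + a * h b"
  shows "fls_map h (f * g) = fls_map h f * g + f * fls_map h g"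
proof (rule fls_eqI)
  fix n
  have h0: "h 0 = 0"
    using assms(1)[of 0 0] by simp
  have hsum: "h (\<Sum>i\<in>I. x i) = (\<Sum>i\<in>I. h (x i))" for x :: "int \<Rightarrow> 'a" and I
    by (induction I rule: infinite_finite_induct) (simp_all add: h0 assms)
  let ?I = "{fls_subdegree f..n-fls_subdegree g}"
  have 1: "fls_nth (f * g) n = (\<Sum>i\<in>?I. fls_nth f i * fls_nth g (n - i))"
    by (rule fls_times_nth_interval) auto
  have 2: "fls_nth (fls_map h f * g) n = (\<Sum>i\<in>?I. fls_nth (fls_map h f) i * fls_nth g (n - i))"
    by (rule fls_times_nth_interval) (auto simp: h0)
  have 3: "fls_nth (f * fls_map h g) n = (\<Sum>i\<in>?I. fls_nth f i * fls_nth (fls_map h g) (n - i))"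
    by (rule fls_times_nth_interval) (auto simp: h0)
  show "fls_nth (fls_map h (f * g)) n = fls_nth (fls_map h f * g + f * fls_map h g) n"
    using 1 2 3 by (simp add: h0 hsum assms(2) sum.distrib)
qed

section \<open>Formal sums\<close>

text \<open>The exact support may be enlarged to any finite set containing it, so that two families
  can be summed over a common index set.\<close>

lemma has_formal_sum_iff:
  "has_formal_sum y I Y \<longleftrightarrow>
     (\<forall>k. \<exists>S. finite S \<and> S \<subseteq> I \<and> (\<forall>i\<in>I - S. lcoeff (y i) k = 0) \<and>
        lcoeff Y k = (\<Sum>i\<in>S. lcoeff (y i) k))"
proof
  assume L: "has_formal_sum y I Y"
  show "\<forall>k. \<exists>S. finite S \<and> S \<subseteq> I \<and> (\<forall>i\<in>I - S. lcoeff (y i) k = 0) \<and>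
        lcoeff Y k = (\<Sum>i\<in>S. lcoeff (y i) k)"
  proof
    fix k
    show "\<exists>S. finite S \<and> S \<subseteq> I \<and> (\<forall>i\<in>I - S. lcoeff (y i) k = 0) \<and>
        lcoeff Y k = (\<Sum>i\<in>S. lcoeff (y i) k)"
      by (rule exI[of _ "{i \<in> I. lcoeff (y i) k \<noteq> 0}"]) (use L in \<open>auto simp: has_formal_sum_def\<close>)
  qed
next
  assume R: "\<forall>k. \<exists>S. finite S \<and> S \<subseteq> I \<and> (\<forall>i\<in>I - S. lcoeff (y i) k = 0) \<and>
        lcoeff Y k = (\<Sum>i\<in>S. lcoeff (y i) k)"
  show "has_formal_sum y I Y"
    unfolding has_formal_sum_def
  proof
    fix k
    obtain S where S: "finite S" "S \<subseteq> I" "\<forall>i\<in>I - S. lcoeff (y i) k = 0"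
        "lcoeff Y k = (\<Sum>i\<in>S. lcoeff (y i) k)"
      using R by blast
    have sub: "{i \<in> I. lcoeff (y i) k \<noteq> 0} \<subseteq> S"
      using S(3) by blast
    moreover have "(\<Sum>i \<in> {i \<in> I. lcoeff (y i) k \<noteq> 0}. lcoeff (y i) k) = (\<Sum>i\<in>S. lcoeff (y i) k)"
      using S(1,2) sub by (intro sum.mono_neutral_left) auto
    ultimately show "finite {i \<in> I. lcoeff (y i) k \<noteq> 0} \<and>
          lcoeff Y k = (\<Sum>i \<in> {i \<in> I. lcoeff (y i) k \<noteq> 0}. lcoeff (y i) k)"
      using S(1,4) finite_subset by auto
  qed
qed

lemma has_formal_sum_lcoeff:
  assumes "has_formal_sum y I Y" "finite S" "S \<subseteq> I" "\<And>i. i \<in> I - S \<Longrightarrow> lcoeff (y i) k = 0"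
  shows "lcoeff Y k = (\<Sum>i\<in>S. lcoeff (y i) k)"
proof -
  have "lcoeff Y k = (\<Sum>i \<in> {i \<in> I. lcoeff (y i) k \<noteq> 0}. lcoeff (y i) k)"
    using assms(1) by (simp add: has_formal_sum_def)
  also have "\<dots> = (\<Sum>i\<in>S. lcoeff (y i) k)"
    using assms(2-) by (intro sum.mono_neutral_left) auto
  finally show ?thesis .
qed

lemma has_formal_sum_unique: "has_formal_sum y I Y \<Longrightarrow> has_formal_sum y I Y' \<Longrightarrow> Y = Y'"
  by (rule lcoeff_eqI) (simp add: has_formal_sum_def)

lemma formal_sum_eqI: "has_formal_sum y I Y \<Longrightarrow> formal_sum y I = Y"
  unfolding formal_sum_def by (rule the_equality) (auto intro: has_formal_sum_unique)

lemma has_formal_sum_diff_finite: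
  assumes "has_formal_sum y I Y" "finite J" "J \<subseteq> I"
  shows "has_formal_sum y (I - J) (Y - sum y J)"
  unfolding has_formal_sum_iff
proof
  fix k
  obtain S where S: "finite S" "S \<subseteq> I" "\<forall>i\<in>I - S. lcoeff (y i) k = 0"
    using assms(1) unfolding has_formal_sum_iff by blast
  have "lcoeff Y k = (\<Sum>i\<in>S \<union> J. lcoeff (y i) k)"
    using S assms by (intro has_formal_sum_lcoeff) auto
  also have "\<dots> = (\<Sum>i\<in>(S - J) \<union> J. lcoeff (y i) k)"
    by simp
  also have "\<dots> = (\<Sum>i\<in>S - J. lcoeff (y i) k) + (\<Sum>i\<in>J. lcoeff (y i) k)"
    using S(1) assms(2) by (intro sum.union_disjoint) auto
  finally have "lcoeff (Y - sum y J) k = (\<Sum>i\<in>S - J. lcoeff (y i) k)"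
    by (simp add: lcoeff_diff lcoeff_sum)
  then show "\<exists>S. finite S \<and> S \<subseteq> I - J \<and> (\<forall>i\<in>I - J - S. lcoeff (y i) k = 0) \<and>
        lcoeff (Y - sum y J) k = (\<Sum>i\<in>S. lcoeff (y i) k)"
    using S by (intro exI[of _ "S - J"]) auto
qed

text \<open>Finiteness at each power of lambda makes every coefficient meaningful; the uniform bound
  \<open>d\<close> makes them the coefficients of a Laurent series.\<close>

lemma has_formal_sum_exists:
  assumes "\<And>k. finite {i \<in> I. lcoeff (y i) k \<noteq> 0}" "\<And>i. i \<in> I \<Longrightarrow> lbounded d (y i)"
  obtains Y where "has_formal_sum y I Y"
proof -
  define c where "c k = (\<Sum>i \<in> {i \<in> I. lcoeff (y i) k \<noteq> 0}. lcoeff (y i) k)" for k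
  have "c k = 0" if "k > d" for k
    using assms(2) that by (auto simp: c_def lbounded_def intro: sum.neutral)
  then obtain Y where "\<And>k. lcoeff Y k = c k"
    using lcoeff_surj by metis
  then have "has_formal_sum y I Y"
    using assms(1) by (simp add: has_formal_sum_def c_def)
  then show ?thesis by (rule that)
qed

section \<open>Homogeneous elements\<close>

lemma sum_UNIV_prod:
  "sum f (UNIV :: ('a::finite \<times> 'b::finite) set) = (\<Sum>k\<in>UNIV. \<Sum>l\<in>UNIV. f (k, l))"
  by (simp add: sum.cartesian_product)

locale grading =
  fixes \<iota> :: "complex \<Rightarrow> 'f::comm_ring_1" and Q :: "'n::finite grading_op"
  assumes constants: "constants_embedding \<iota>" and scale_pos: "fst Q > 0"
begin

lemma emb_1 [simp]: "\<iota> 1 = 1" and emb_add: "\<iota> (a + b) = \<iota> a + \<iota> b"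
  and emb_mult: "\<iota> (a * b) = \<iota> a * \<iota> b"
  using constants by (auto simp: constants_embedding_def)

lemma emb_0 [simp]: "\<iota> 0 = 0"
  using emb_add[of 0 0] by simp

lemma emb_minus: "\<iota> (- a) = - \<iota> a"
  using emb_add[of a "- a"] by (simp add: minus_unique)

lemma emb_diff: "\<iota> (a - b) = \<iota> a - \<iota> b"
  using emb_add[of a "- b"] by (simp add: emb_minus)

lemma emb_sum: "\<iota> (sum f I) = (\<Sum>i\<in>I. \<iota> (f i))"
  by (induction I rule: infinite_finite_induct) (simp_all add: emb_add)

lemma emb_of_nat [simp]: "\<iota> (of_nat n) = of_nat n"
  by (induction n) (simp_all add: emb_add)

lemma emb_of_int [simp]: "\<iota> (of_int n) = of_int n"
  by (cases n) (simp_all add: emb_minus emb_diff)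

text \<open>\<open>'f\<close> may have zero divisors, but a nonzero complex number has an inverse,
  whose image under \<open>\<iota>\<close> is an inverse in \<open>'f\<close>.\<close>

lemma smul_emb_cancel:
  assumes "smul (\<iota> a) A = 0" "a \<noteq> 0"
  shows "A = 0"
proof -
  have "smul (\<iota> (inverse a)) (smul (\<iota> a) A) = smul (\<iota> (inverse a * a)) A"
    by (simp add: smul_smul emb_mult)
  then show ?thesis
    using assms by simp
qed

abbreviation H :: "'f ^ 'n ^ 'n" where
  "H \<equiv> map_matrix \<iota> (snd Q)"

abbreviation hom :: "int \<Rightarrow> ('f, 'n) loop_mat \<Rightarrow> bool" where
  "hom \<equiv> homogeneous \<iota> Q"

text \<open>On the coefficient of lambda^k the grading operator acts as \<open>c * k\<close> plus ad
  H. This is therefore the eigenvalue of ad H forced on that coefficient in grade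
  \<open>n\<close>.\<close>

definition weight :: "int \<Rightarrow> int \<Rightarrow> complex" where
  "weight n k = of_int n - of_real (fst Q) * of_int k"

lemma lcoeff_ad_grading:
  "lcoeff (ad_grading \<iota> Q Y) k
     = smul (\<iota> (of_real (fst Q)) * of_int k) (lcoeff Y k) + mcomm H (lcoeff Y k)"
  by (simp add: vec_eq_iff ad_grading_def mcomm_def fls_X_times_conv_shift matrix_matrix_mult_def
      fls_nth_sum algebra_simps)

lemma hom_iff: "hom n Y \<longleftrightarrow> (\<forall>k. mcomm H (lcoeff Y k) = smul (\<iota> (weight n k)) (lcoeff Y k))"
proof -
  have w: "\<iota> (weight n k) = of_int n - \<iota> (of_real (fst Q)) * of_int k" for k
    by (simp add: weight_def emb_diff emb_mult)
  have n: "lcoeff (smul (of_int n) Y) k = smul (of_int n) (lcoeff Y k)" for k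
    by (simp add: vec_eq_iff)
  have "hom n Y \<longleftrightarrow> (\<forall>k. lcoeff (ad_grading \<iota> Q Y) k = lcoeff (smul (of_int n) Y) k)"
    unfolding homogeneous_def by (metis lcoeff_eqI)
  also have "\<dots> \<longleftrightarrow> (\<forall>k. mcomm H (lcoeff Y k) = smul (\<iota> (weight n k)) (lcoeff Y k))"
    unfolding lcoeff_ad_grading n w smul_diff_left by (simp add: algebra_simps eq_diff_eq)
  finally show ?thesis .
qed

lemma hom_0 [simp]: "hom n 0"
  by (simp add: hom_iff)

lemma hom_add: "hom n A \<Longrightarrow> hom n B \<Longrightarrow> hom n (A + B)"
  by (simp add: hom_iff lcoeff_add mcomm_add smul_add)

lemma hom_smul: "hom n A \<Longrightarrow> hom n (smul (fls_const a) A)"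
  by (simp add: hom_iff mcomm_smul smul_smul mult.commute)

lemma smul_const_minus_1: "smul (fls_const (- 1)) A = - A"
  for A :: "('f, 'n) loop_mat"
  by (simp add: vec_eq_iff)

lemma hom_diff: "hom n A \<Longrightarrow> hom n B \<Longrightarrow> hom n (A - B)"
  using hom_add[of n A "- B"] hom_smul[of n B "- 1", unfolded smul_const_minus_1] by simp

lemma hom_sum: "(\<And>i. i \<in> I \<Longrightarrow> hom n (f i)) \<Longrightarrow> hom n (sum f I)"
  by (induction I rule: infinite_finite_induct) (simp_all add: hom_add)

lemma ad_grading_mult: "ad_grading \<iota> Q (A ** B) = ad_grading \<iota> Q A ** B + A ** ad_grading \<iota> Q B"
proof -
  have "map_matrix (\<lambda>f. - (fls_X * fls_deriv f)) (A ** B)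
      = map_matrix (\<lambda>f. - (fls_X * fls_deriv f)) A ** B + A ** map_matrix (\<lambda>f. - (fls_X * fls_deriv f)) B"
    by (simp add: vec_eq_iff matrix_matrix_mult_def fls_deriv_sum algebra_simps sum_distrib_left
        sum_negf sum.distrib)
  then show ?thesis
    by (simp add: ad_grading_def mcomm_mult matrix_dists smul_add smul_mult_left smul_mult_right)
qed

lemma hom_mult: "hom m A \<Longrightarrow> hom n B \<Longrightarrow> hom (m + n) (A ** B)"
  by (simp add: homogeneous_def ad_grading_mult smul_mult_left smul_mult_right smul_add_left)

lemma hom_1 [simp]: "hom 0 (mat 1)"
proof -
  have "lcoeff (mat 1) k = (if k = 0 then mat 1 else (0 :: 'f^'n^'n))" for k
    by (simp add: vec_eq_iff mat_def)
  moreover have "mcomm H (mat 1) = 0"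
    by (simp add: mcomm_def)
  ultimately show ?thesis
    by (simp add: hom_iff weight_def)
qed

text \<open>The usual induction: ad H minus the \<open>j\<close>-th eigenvalue removes the
  \<open>j\<close>-th vector and multiplies the others by differences of eigenvalues. These are
  nonzero complex numbers, hence cancellable over \<open>'f\<close>.\<close>

lemma eigenvectors_independent:
  assumes "finite I" "inj_on \<mu> I" "\<And>i. i \<in> I \<Longrightarrow> mcomm H (a i) = smul (\<iota> (\<mu> i)) (a i)"
    "(\<Sum>i\<in>I. a i) = 0"
  shows "\<forall>i\<in>I. a i = 0"
  using assms
proof (induction I arbitrary: a rule: finite_induct)
  case (insert j I)
  have "mcomm H (\<Sum>i\<in>insert j I. a i) - smul (\<iota> (\<mu> j)) (\<Sum>i\<in>insert j I. a i)
      = (\<Sum>i\<in>insert j I. mcomm H (a i) - smul (\<iota> (\<mu> j)) (a i))"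
    by (simp add: mcomm_sum smul_sum sum_subtractf del: sum.insert)
  also have "\<dots> = (\<Sum>i\<in>insert j I. smul (\<iota> (\<mu> i - \<mu> j)) (a i))"
    using insert.prems(2) by (intro sum.cong) (simp_all add: emb_diff smul_diff_left)
  also have "\<dots> = (\<Sum>i\<in>I. smul (\<iota> (\<mu> i - \<mu> j)) (a i))"
    using insert.hyps by simp
  finally have "(\<Sum>i\<in>I. smul (\<iota> (\<mu> i - \<mu> j)) (a i)) = 0"
    by (simp only: insert.prems(3) mcomm_0 smul_0 diff_0_right)
  moreover have "inj_on \<mu> I"
    using insert.prems(1) by (simp add: inj_on_insert)
  ultimately have "\<forall>i\<in>I. smul (\<iota> (\<mu> i - \<mu> j)) (a i) = 0"
    using insert.prems(2) by (intro insert.IH) (simp_all add: mcomm_smul smul_smul mult.commute)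
  moreover have "\<mu> i - \<mu> j \<noteq> 0" if "i \<in> I" for i
    using that insert.prems(1) insert.hyps(2) inj_onD[OF insert.prems(1), of i j] by auto
  ultimately have "\<forall>i\<in>I. a i = 0"
    using smul_emb_cancel by blast
  moreover from this have "a j = 0"
    using insert.prems(3) insert.hyps by simp
  ultimately show ?case by simp
qed simp

lemma inj_weight: "inj_on (\<lambda>n. weight n k) I"
  by (simp add: inj_on_def weight_def)

lemma hom_lcoeff_independent:
  assumes "finite I" "\<And>i. i \<in> I \<Longrightarrow> hom i (y i)" "(\<Sum>i\<in>I. lcoeff (y i) k) = 0" "i \<in> I"
  shows "lcoeff (y i) k = 0"
proof -
  have "\<forall>i\<in>I. lcoeff (y i) k = 0"
    by (rule eigenvectors_independent[where \<mu> = "\<lambda>n. weight n k"])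
      (use assms inj_weight in \<open>auto simp: hom_iff\<close>)
  then show ?thesis using assms(4) by blast
qed

text \<open>
  A resolvent of the complex matrix of \<open>ad H\<close> outside a Gershgorin disc remains a resolvent after
  extension of scalars to \<open>'f\<close>, a ring without a norm.
\<close>

lemma eigenvalue_bound:
  "\<exists>B. \<forall>\<mu> a. mcomm H a = smul (\<iota> \<mu>) a \<longrightarrow> a \<noteq> 0 \<longrightarrow> cmod \<mu> \<le> B"
proof -
  \<comment> \<open>The matrix of ad \<open>snd Q\<close> on the space of matrices, with pairs of
    indices as coordinates.\<close>
  define M :: "complex ^ ('n \<times> 'n) ^ ('n \<times> 'n)" where
    "M = (\<chi> p q. (if snd p = snd q then snd Q $ fst p $ fst q else 0)
                 - (if fst p = fst q then snd Q $ snd q $ snd p else 0))"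
  \<comment> \<open>The sum of the moduli of all entries dominates every row sum.\<close>
  define B where "B = (\<Sum>p\<in>UNIV. \<Sum>q\<in>UNIV. cmod (M $ p $ q))"
  have "cmod \<mu> \<le> B" if eig: "mcomm H a = smul (\<iota> \<mu>) a" and "a \<noteq> 0" for \<mu> a
  proof (rule ccontr)
    assume big: "\<not> cmod \<mu> \<le> B"
    \<comment> \<open>Gershgorin's argument: at the coordinate where a kernel vector is largest in
      modulus, its row equation would give \<open>cmod \<mu> \<le> B\<close>.\<close>
    have "v = 0" if v: "(M - mat \<mu>) *v v = 0" for v
    proof (rule ccontr)
      assume "v \<noteq> 0"
      then obtain p0 where p0: "v $ p0 \<noteq> 0" by (auto simp: vec_eq_iff)
      obtain p where p: "\<And>q. cmod (v $ q) \<le> cmod (v $ p)"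
      proof -
        let ?S = "range (\<lambda>q. cmod (v $ q))"
        have "Max ?S \<in> ?S" by (rule Max_in) auto
        then obtain p where "Max ?S = cmod (v $ p)" by (rule imageE)
        then show ?thesis using that[of p] by (metis Max_ge finite finite_imageI rangeI)
      qed
      have "(\<Sum>q\<in>UNIV. M $ p $ q * v $ q) = \<mu> * v $ p"
      proof -
        have "(M *v v) $ p = (mat \<mu> *v v) $ p"
          using v by (simp add: matrix_vector_mult_diff_rdistrib)
        moreover have "(mat \<mu> *v v) $ p = \<mu> * v $ p"
          by (simp add: matrix_vector_mult_def mat_def if_distribR if_distrib cong: if_cong)
        ultimately show ?thesis by (simp add: matrix_vector_mult_def)
      qed
      then have "cmod \<mu> * cmod (v $ p) = cmod (\<Sum>q\<in>UNIV. M $ p $ q * v $ q)"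
        by (simp add: norm_mult)
      also have "\<dots> \<le> (\<Sum>q\<in>UNIV. cmod (M $ p $ q) * cmod (v $ p))"
        by (rule order_trans[OF norm_sum]) (simp add: norm_mult mult_left_mono p sum_mono)
      also have "\<dots> = (\<Sum>q\<in>UNIV. cmod (M $ p $ q)) * cmod (v $ p)"
        by (simp add: sum_distrib_right)
      also have "\<dots> \<le> B * cmod (v $ p)"
        unfolding B_def by (intro mult_right_mono member_le_sum) (auto simp: sum_nonneg)
      finally have "cmod (v $ p) = 0"
        using big by (auto simp: mult_le_cancel_right)
      then show False using p[of p0] p0 by simp
    qed
    \<comment> \<open>The left inverse is the bridge to \<open>'f\<close>: this identity between
      complex matrices is preserved by \<open>\<iota>\<close>, whereas the norm estimate has no
      analogue there.\<close>
    then obtain N where N: "N ** (M - mat \<mu>) = mat 1"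
      using matrix_left_invertible_ker by blast
    define w where "w = (\<chi> p. a $ fst p $ snd p)"
    have "map_matrix \<iota> M *v w = (\<chi> p. mcomm H a $ fst p $ snd p)"
    proof -
      have "(map_matrix \<iota> M *v w) $ (i, j) = mcomm H a $ i $ j" for i j
      proof -
        have "(map_matrix \<iota> M *v w) $ (i, j)
            = (\<Sum>q\<in>UNIV. \<iota> (if j = snd q then snd Q $ i $ fst q else 0) * a $ fst q $ snd q)
            - (\<Sum>q\<in>UNIV. \<iota> (if i = fst q then snd Q $ snd q $ j else 0) * a $ fst q $ snd q)"
          by (simp add: matrix_vector_mult_def M_def w_def emb_diff left_diff_distrib sum_subtractf
              cong: if_cong)
        also have "(\<Sum>q\<in>UNIV. \<iota> (if j = snd q then snd Q $ i $ fst q else 0) * a $ fst q $ snd q)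
            = (\<Sum>k\<in>UNIV. \<Sum>l\<in>UNIV. \<iota> (if j = l then snd Q $ i $ k else 0) * a $ k $ l)"
          by (simp only: sum_UNIV_prod fst_conv snd_conv)
        also have "\<dots> = (H ** a) $ i $ j"
          by (simp add: if_distrib if_distribR matrix_matrix_mult_def cong: if_cong)
        also have "(\<Sum>q\<in>UNIV. \<iota> (if i = fst q then snd Q $ snd q $ j else 0) * a $ fst q $ snd q)
            = (\<Sum>k\<in>UNIV. \<Sum>l\<in>UNIV. \<iota> (if i = k then snd Q $ l $ j else 0) * a $ k $ l)"
          by (simp only: sum_UNIV_prod fst_conv snd_conv)
        also have "\<dots> = (\<Sum>l\<in>UNIV. \<Sum>k\<in>UNIV. \<iota> (if i = k then snd Q $ l $ j else 0) * a $ k $ l)"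
          by (rule sum.swap)
        also have "\<dots> = (a ** H) $ i $ j"
          by (simp add: if_distrib if_distribR matrix_matrix_mult_def mult.commute cong: if_cong)
        finally show ?thesis by (simp add: mcomm_def)
      qed
      then show ?thesis by (simp add: vec_eq_iff)
    qed
    also have "\<dots> = map_matrix \<iota> (mat \<mu>) *v w"
      by (simp add: eig vec_eq_iff w_def matrix_vector_mult_def mat_def if_distrib if_distribR cong: if_cong)
    finally have "map_matrix \<iota> (M - mat \<mu>) *v w = 0"
      by (simp add: vec_eq_iff matrix_vector_mult_def emb_diff left_diff_distrib sum_subtractf)
    moreover have "map_matrix \<iota> N ** map_matrix \<iota> (M - mat \<mu>) = mat 1"
    proof -
      have "map_matrix \<iota> (N ** (M - mat \<mu>)) = mat 1"
        unfolding N by (simp add: vec_eq_iff mat_def)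
      then show ?thesis
        by (simp add: vec_eq_iff matrix_matrix_mult_def emb_sum emb_mult)
    qed
    ultimately have "w = 0"
      by (metis matrix_vector_mul_assoc matrix_vector_mul_lid matrix_vector_mult_0_right)
    then have "a = 0"
      by (auto simp: w_def vec_eq_iff)
    with \<open>a \<noteq> 0\<close> show False by simp
  qed
  then show ?thesis by blast
qed

lemma hom_support_bound:
  obtains B :: real where "\<And>n Y k. hom n Y \<Longrightarrow> lcoeff Y k \<noteq> 0 \<Longrightarrow> \<bar>of_int n - fst Q * of_int k\<bar> \<le> B"
proof -
  obtain B where B: "\<And>\<mu> a. mcomm H a = smul (\<iota> \<mu>) a \<Longrightarrow> a \<noteq> 0 \<Longrightarrow> cmod \<mu> \<le> B"
    using eigenvalue_bound by blast
  have "weight n k = of_real (of_int n - fst Q * of_int k)" for n k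
    by (simp add: weight_def)
  then have "cmod (weight n k) = \<bar>of_int n - fst Q * of_int k\<bar>" for n k
    by (simp only: norm_of_real)
  then show ?thesis
    using that B hom_iff by metis
qed

text \<open>First comparison of the filtrations: as the grade tends to minus infinity, so does the
  order in lambda.\<close>

lemma hom_lbounded:
  obtains \<phi> :: "int \<Rightarrow> int" where "mono \<phi>" "\<And>d. \<exists>n. \<phi> n \<le> d"
    "\<And>n Y. hom n Y \<Longrightarrow> lbounded (\<phi> n) Y"
proof -
  obtain B :: real where B: "\<And>n Y k. hom n Y \<Longrightarrow> lcoeff Y k \<noteq> 0 \<Longrightarrow> \<bar>of_int n - fst Q * of_int k\<bar> \<le> B"
    using hom_support_bound by blast
  \<comment> \<open>Solving \<open>n - c * k \<ge> - B\<close> for \<open>k\<close>, with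
    \<open>c = fst Q > 0\<close>, bounds the exponents that occur.\<close>
  define \<phi> where "\<phi> n = \<lceil>(of_int n + B) / fst Q\<rceil>" for n
  show ?thesis
  proof
    show "mono \<phi>"
      using scale_pos by (auto simp: \<phi>_def mono_def intro!: ceiling_mono divide_right_mono)
    show "\<exists>n. \<phi> n \<le> d" for d
    proof
      have "of_int \<lfloor>fst Q * of_int d - B\<rfloor> + B \<le> fst Q * of_int d"
        by linarith
      then show "\<phi> \<lfloor>fst Q * of_int d - B\<rfloor> \<le> d"
        using scale_pos by (simp add: \<phi>_def ceiling_le_iff divide_le_eq mult.commute)
    qed
    show "lbounded (\<phi> n) Y" if Y: "hom n Y" for n Y
      unfolding lbounded_def
    proof (intro allI impI, rule ccontr)
      fix k assume k: "k > \<phi> n" and nz: "lcoeff Y k \<noteq> 0"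
      from k have "(of_int n + B) / fst Q < of_int k"
        unfolding \<phi>_def by linarith
      then have "of_int n + B < fst Q * of_int k"
        using scale_pos by (simp add: divide_less_eq mult.commute)
      with B[OF Y nz] show False by linarith
    qed
  qed
qed

text \<open>The opposite comparison: grade \<open>n\<close> contains no very low powers of lambda.
  It turns closeness in lambda into equality of homogeneous components.\<close>

lemma hom_lbounded_imp_0:
  obtains D :: "int \<Rightarrow> int" where "mono D" "\<And>n Y. hom n Y \<Longrightarrow> lbounded (D n) Y \<Longrightarrow> Y = 0"
proof -
  obtain B :: real where B: "\<And>n Y k. hom n Y \<Longrightarrow> lcoeff Y k \<noteq> 0 \<Longrightarrow> \<bar>of_int n - fst Q * of_int k\<bar> \<le> B"
    using hom_support_bound by blast
  \<comment> \<open>The \<open>- 1\<close> makes \<open>k \<le> D n\<close> imply the strict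
    inequality \<open>k < (n - B) / c\<close>, which contradicts the support bound.\<close>
  define D where "D n = \<lceil>(of_int n - B) / fst Q\<rceil> - 1" for n
  show ?thesis
  proof
    show "mono D"
      using scale_pos unfolding D_def mono_def
      by (intro allI impI diff_right_mono ceiling_mono divide_right_mono) auto
    show "Y = 0" if Y: "hom n Y" "lbounded (D n) Y" for n Y
    proof (rule lcoeff_eqI, rule ccontr)
      fix k assume "lcoeff Y k \<noteq> lcoeff 0 k"
      then have nz: "lcoeff Y k \<noteq> 0" by simp
      then have "k \<le> D n"
        using Y(2) by (meson lbounded_def not_le)
      then have "of_int k < (of_int n - B) / fst Q"
        unfolding D_def by linarith
      then have "fst Q * of_int k < of_int n - B"
        using scale_pos by (simp add: less_divide_eq mult.commute)
      with B[OF Y(1) nz] show False by linarith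
    qed
  qed
qed

section \<open>Grade expansions\<close>

text \<open>At each power of lambda only finitely many grades contribute, and they are independent
  there. This makes the description in \<open>grade_part\<close> definite.\<close>

lemma grade_expansion_unique:
  assumes "grade_expansion \<iota> Q Y y" "grade_expansion \<iota> Q Y z"
  shows "y = z"
proof (rule ext, rule lcoeff_eqI)
  fix i k
  have fin: "finite {i. lcoeff (y i) k \<noteq> 0}" "finite {i. lcoeff (z i) k \<noteq> 0}"
    using assms by (auto simp: grade_expansion_def has_formal_sum_def)
  \<comment> \<open>Inserting \<open>i\<close> ensures membership even when both coefficients at
    \<open>i\<close> vanish.\<close>
  define S where "S = insert i ({i. lcoeff (y i) k \<noteq> 0} \<union> {i. lcoeff (z i) k \<noteq> 0})"
  have S: "finite S" using fin by (simp add: S_def)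
  have "lcoeff Y k = (\<Sum>i\<in>S. lcoeff (y i) k)"
    by (rule has_formal_sum_lcoeff[of y UNIV])
      (use assms S in \<open>auto simp: grade_expansion_def S_def\<close>)
  moreover have "lcoeff Y k = (\<Sum>i\<in>S. lcoeff (z i) k)"
    by (rule has_formal_sum_lcoeff[of z UNIV])
      (use assms S in \<open>auto simp: grade_expansion_def S_def\<close>)
  ultimately have "(\<Sum>i\<in>S. lcoeff (y i - z i) k) = 0"
    by (simp add: lcoeff_diff sum_subtractf)
  then have "lcoeff (y i - z i) k = 0"
    by (rule hom_lcoeff_independent[rotated 2])
      (use assms S in \<open>auto simp: grade_expansion_def S_def intro: hom_diff\<close>)
  then show "lcoeff (y i) k = lcoeff (z i) k"
    by (simp add: lcoeff_diff)
qed

lemma grade_part_eqI: "grade_expansion \<iota> Q Y y \<Longrightarrow> grade_part \<iota> Q Y = y"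
  unfolding grade_part_def by (rule the_equality) (auto intro: grade_expansion_unique)

text \<open>A grade may occur repeatedly in the inductive form, so closure under addition and under
  additive maps is a plain rule induction; equal grades are merged in
  \<open>finitely_graded_components\<close>.\<close>

inductive finitely_graded :: "int \<Rightarrow> ('f, 'n) loop_mat \<Rightarrow> bool" for n where
  zero: "finitely_graded n 0"
| add: "hom i y \<Longrightarrow> i \<le> n \<Longrightarrow> finitely_graded n Z \<Longrightarrow> finitely_graded n (y + Z)"

lemma finitely_graded_hom: "hom i y \<Longrightarrow> i \<le> n \<Longrightarrow> finitely_graded n y"
  using finitely_graded.add[OF _ _ finitely_graded.zero] by fastforce

lemma finitely_graded_add: "finitely_graded n A \<Longrightarrow> finitely_graded n B \<Longrightarrow> finitely_graded n (A + B)"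
  by (induction rule: finitely_graded.induct) (auto simp: add.assoc intro: finitely_graded.add)

lemma finitely_graded_sum:
  "(\<And>i. i \<in> I \<Longrightarrow> finitely_graded n (f i)) \<Longrightarrow> finitely_graded n (sum f I)"
  by (induction I rule: infinite_finite_induct) (auto intro: finitely_graded_add finitely_graded.zero)

lemma finitely_graded_map:
  assumes "finitely_graded n A" "F 0 = 0" "\<And>A B. F (A + B) = F A + F B"
    "\<And>i y. i \<le> n \<Longrightarrow> hom i y \<Longrightarrow> finitely_graded m (F y)"
  shows "finitely_graded m (F A)"
  using assms(1) by induction (auto simp: assms intro: finitely_graded_add finitely_graded.zero)

lemma finitely_graded_mult:
  assumes "finitely_graded m A" "finitely_graded n B"
  shows "finitely_graded (m + n) (A ** B)"
proof (rule finitely_graded_map[OF assms(1), of "\<lambda>A. A ** B"])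
  fix i y assume i: "i \<le> m" and y: "hom i y"
  show "finitely_graded (m + n) (y ** B)"
    by (rule finitely_graded_map[OF assms(2)])
      (use i in \<open>auto simp: matrix_dists intro: finitely_graded_hom[OF hom_mult[OF y]]\<close>)
qed (simp_all add: matrix_dists)

lemma finitely_graded_lbounded:
  obtains \<phi> :: "int \<Rightarrow> int" where "\<And>d. \<exists>n. \<phi> n \<le> d" "\<And>n Z. finitely_graded n Z \<Longrightarrow> lbounded (\<phi> n) Z"
proof -
  obtain \<phi> :: "int \<Rightarrow> int" where \<phi>: "mono \<phi>" "\<And>d. \<exists>n. \<phi> n \<le> d" "\<And>n Y. hom n Y \<Longrightarrow> lbounded (\<phi> n) Y"
    by (rule hom_lbounded) blast
  have "lbounded (\<phi> n) Z" if "finitely_graded n Z" for n Z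
    using that
  proof induction
    case (add i y Z)
    then show ?case
      using \<phi>(3)[of i y] monoD[OF \<phi>(1), of i n] by (blast intro: lbounded_add lbounded_mono)
  qed simp
  with \<phi>(2) show ?thesis by (rule that)
qed

lemma finitely_graded_components:
  assumes "finitely_graded n Z"
  obtains z where "\<And>i. hom i (z i)" "\<And>i. i > n \<Longrightarrow> z i = 0" "finite {i. z i \<noteq> 0}" "has_formal_sum z UNIV Z"
proof -
  have "\<exists>z. (\<forall>i. hom i (z i)) \<and> (\<forall>i>n. z i = 0) \<and> (\<exists>S. finite S \<and> (\<forall>i. i \<notin> S \<longrightarrow> z i = 0) \<and> Z = sum z S)"
    using assms
  proof induction
    case zero
    show ?case by (rule exI[of _ "\<lambda>i. 0"]) auto
  next
    case (add j y Z)
    then obtain z S where z: "\<And>i. hom i (z i)" "\<And>i. i>n \<Longrightarrow> z i = 0"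
      "finite S" "\<And>i. i \<notin> S \<Longrightarrow> z i = 0" "Z = sum z S" by blast
    define z' where "z' = z(j := y + z j)"
    have "sum z' (insert j S) = z' j + sum z' (S - {j})"
      using z(3) by (simp add: sum.insert_remove)
    also have "sum z' (S - {j}) = sum z (S - {j})"
      by (intro sum.cong) (auto simp: z'_def)
    also have "z' j + sum z (S - {j}) = y + sum z (insert j S)"
      using z(3) by (simp add: z'_def sum.insert_remove)
    also have "sum z (insert j S) = Z"
      using z(3,4,5) by (cases "j \<in> S") (auto simp: insert_absorb)
    finally have "y + Z = sum z' (insert j S)" ..
    moreover have "hom i (z' i)" for i
      using z(1) add.hyps by (simp add: z'_def hom_add)
    moreover have "z' i = 0" if "i > n" for i
      using that z(2) add.hyps by (auto simp: z'_def)
    moreover have "z' i = 0" if "i \<notin> insert j S" for i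
      using that z(4) by (auto simp: z'_def)
    ultimately show ?case
      using z(3) by (intro exI[of _ z'] conjI exI[of _ "insert j S"]) auto
  qed
  then obtain z S where z: "\<And>i. hom i (z i)" "\<And>i. i>n \<Longrightarrow> z i = 0"
      "finite S" "\<And>i. i \<notin> S \<Longrightarrow> z i = 0" "Z = sum z S" by blast
  have "has_formal_sum z UNIV Z"
    unfolding has_formal_sum_iff
    by (intro allI exI[of _ S]) (use z in \<open>auto simp: lcoeff_sum\<close>)
  moreover have "finite {i. z i \<noteq> 0}"
    by (rule finite_subset[OF _ z(3)]) (use z(4) in blast)
  ultimately show ?thesis
    using that z by blast
qed

text \<open>
  Defining the elements of grade at most \<open>n\<close> as a closure with respect to the order in \<open>\<lambda>\<close>,
  rather than by grade expansions, avoids Cauchy products of expansions: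
  products and derivations are continuous, and the expansion is recovered in
  \<open>grade_le_imp_grade_expansion\<close>.
\<close>

definition grade_le :: "int \<Rightarrow> ('f, 'n) loop_mat \<Rightarrow> bool" where
  "grade_le n Y \<longleftrightarrow> (\<forall>d. \<exists>Z. finitely_graded n Z \<and> lbounded d (Y - Z))"

section \<open>Elements of bounded grade: sums, products and convergent series\<close>

lemma finitely_graded_imp_grade_le: "finitely_graded n Y \<Longrightarrow> grade_le n Y"
  unfolding grade_le_def by (intro allI exI[of _ Y]) simp

lemma grade_le_hom: "hom i Y \<Longrightarrow> i \<le> n \<Longrightarrow> grade_le n Y"
  by (blast intro: finitely_graded_imp_grade_le finitely_graded_hom)

lemma grade_le_0 [simp]: "grade_le n 0"
  by (simp add: finitely_graded_imp_grade_le finitely_graded.zero)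

lemma grade_le_mono:
  assumes "grade_le m Y" "m \<le> n"
  shows "grade_le n Y"
proof -
  have "finitely_graded n Z" if "finitely_graded m Z" for Z
    using that
    by induction (use assms(2) in \<open>auto intro: finitely_graded.intros\<close>)
  then show ?thesis
    using assms(1) unfolding grade_le_def by blast
qed

text \<open>An additive map that is continuous in lambda sends good approximations to good ones, so
  its effect on grades is decided on homogeneous elements.\<close>

lemma grade_le_map:
  assumes "grade_le n A" "\<And>A B. F (A + B) = F A + F B"
    "\<And>d. \<exists>e. \<forall>A. lbounded e A \<longrightarrow> lbounded d (F A)"
    "\<And>i y. i \<le> n \<Longrightarrow> hom i y \<Longrightarrow> finitely_graded m (F y)"
  shows "grade_le m (F A)"
  unfolding grade_le_def
proof
  fix d
  obtain e where e: "\<And>A. lbounded e A \<Longrightarrow> lbounded d (F A)"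
    using assms(3) by blast
  obtain Z where Z: "finitely_graded n Z" "lbounded e (A - Z)"
    using assms(1) by (auto simp: grade_le_def)
  have "F 0 = 0"
    using assms(2)[of 0 0] by simp
  then have "finitely_graded m (F Z)"
    by (rule finitely_graded_map[OF Z(1), of F]) (use assms(2,4) in auto)
  moreover have "F A - F Z = F (A - Z)"
    using assms(2)[of "A - Z" Z] by simp
  ultimately show "\<exists>Z. finitely_graded m Z \<and> lbounded d (F A - Z)"
    using e[OF Z(2)] by auto
qed

lemma grade_le_add:
  assumes "grade_le n A" "grade_le n B"
  shows "grade_le n (A + B)"
  unfolding grade_le_def
proof
  fix d
  obtain Z Z' where Z: "finitely_graded n Z" "lbounded d (A - Z)" "finitely_graded n Z'" "lbounded d (B - Z')"
    using assms by (meson grade_le_def)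
  then have "finitely_graded n (Z + Z')" "lbounded d ((A - Z) + (B - Z'))"
    by (auto intro: finitely_graded_add lbounded_add)
  then show "\<exists>Z. finitely_graded n Z \<and> lbounded d (A + B - Z)"
    by (intro exI[of _ "Z + Z'"]) (simp add: algebra_simps)
qed

lemma grade_le_smul: "grade_le n A \<Longrightarrow> grade_le n (smul (fls_const a) A)"
  by (erule grade_le_map)
    (auto simp: smul_add intro: lbounded_smul finitely_graded_hom[OF hom_smul])

lemma grade_le_diff: "grade_le n A \<Longrightarrow> grade_le n B \<Longrightarrow> grade_le n (A - B)"
  using grade_le_add[of n A "- B"] grade_le_smul[of n B "- 1", unfolded smul_const_minus_1] by simp

lemma grade_le_sum: "(\<And>i. i \<in> I \<Longrightarrow> grade_le n (f i)) \<Longrightarrow> grade_le n (sum f I)"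
  by (induction I rule: infinite_finite_induct) (simp_all add: grade_le_add)

lemma grade_le_closed:
  assumes "\<And>d. \<exists>Z. grade_le n Z \<and> lbounded d (Y - Z)"
  shows "grade_le n Y"
  unfolding grade_le_def
proof
  fix d
  obtain Z Z' where Z: "lbounded d (Y - Z)" "finitely_graded n Z'" "lbounded d (Z - Z')"
    using assms by (meson grade_le_def)
  then have "lbounded d ((Y - Z) + (Z - Z'))"
    by (blast intro: lbounded_add)
  with Z(2) show "\<exists>Z. finitely_graded n Z \<and> lbounded d (Y - Z)"
    by auto
qed

text \<open>One factor is approximated at a time. If \<open>B\<close> has order at most
  \<open>e\<close>, an error of order \<open>d - e\<close> in \<open>A\<close> costs at most order
  \<open>d\<close> in the product; left multiplication by the approximant is then additive and
  continuous.\<close>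

lemma grade_le_mult:
  assumes "grade_le m A" "grade_le n B"
  shows "grade_le (m + n) (A ** B)"
proof (rule grade_le_closed)
  fix d
  obtain e where e: "lbounded e B"
    using lbounded_exists by blast
  obtain Z where Z: "finitely_graded m Z" "lbounded (d - e) (A - Z)"
    using assms(1) by (meson grade_le_def)
  have "grade_le (m + n) (Z ** B)"
  proof (rule grade_le_map[OF assms(2)])
    obtain c where "lbounded c Z"
      using lbounded_exists by blast
    then show "\<exists>e. \<forall>A. lbounded e A \<longrightarrow> lbounded d (Z ** A)" for d
      using lbounded_mult[of c Z "d - c"] by (intro exI[of _ "d - c"]) simp
  qed (auto simp: matrix_dists intro: finitely_graded_mult[OF Z(1)] finitely_graded_hom)
  moreover have "lbounded d (A ** B - Z ** B)"
    using lbounded_mult[OF Z(2) e] by (simp add: matrix_dists)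
  ultimately show "\<exists>Z. grade_le (m + n) Z \<and> lbounded d (A ** B - Z)"
    by blast
qed

lemma grade_le_lbounded:
  obtains \<phi> :: "int \<Rightarrow> int" where "\<And>d. \<exists>n. \<phi> n \<le> d" "\<And>n Z. grade_le n Z \<Longrightarrow> lbounded (\<phi> n) Z"
proof -
  obtain \<phi> :: "int \<Rightarrow> int" where \<phi>: "\<And>d. \<exists>n. \<phi> n \<le> d" "\<And>n Z. finitely_graded n Z \<Longrightarrow> lbounded (\<phi> n) Z"
    by (rule finitely_graded_lbounded) blast
  have "lbounded (\<phi> n) Y" if Y: "grade_le n Y" for n Y
  proof -
    obtain Z where "finitely_graded n Z" "lbounded (\<phi> n) (Y - Z)"
      using Y by (meson grade_le_def)
    then have "lbounded (\<phi> n) ((Y - Z) + Z)"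
      using \<phi>(2) by (intro lbounded_add)
    then show ?thesis by simp
  qed
  with \<phi>(1) show ?thesis by (rule that)
qed

text \<open>The grade filtration is separated because low grade forces low order in lambda.
  Identities between infinite series are verified through this, one truncation at a time.\<close>

lemma grade_le_all_imp_0:
  assumes "\<And>N. grade_le (- int N) Y"
  shows "Y = 0"
proof (rule lbounded_all_imp_0)
  fix d
  obtain \<phi> :: "int \<Rightarrow> int" where \<phi>: "\<And>d. \<exists>n. \<phi> n \<le> d" "\<And>n Z. grade_le n Z \<Longrightarrow> lbounded (\<phi> n) Z"
    by (rule grade_le_lbounded) blast
  obtain n where n: "\<phi> n \<le> d"
    using \<phi>(1) by blast
  have "grade_le n Y"
    by (rule grade_le_mono[OF assms[of "nat (- n)"]]) simp
  then show "lbounded d Y"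
    using \<phi>(2) n lbounded_mono by blast
qed

text \<open>The order in lambda of the \<open>i\<close>-th term tends to minus infinity with its
  grade, so each power of lambda receives finitely many terms. The second part bounds the grade of
  the remainder after truncation at \<open>N\<close>.\<close>

lemma grade_le_formal_sum:
  assumes y: "\<And>i::nat. i \<in> I \<Longrightarrow> grade_le (- int i) (y i)"
  shows "has_formal_sum y I (formal_sum y I)"
    and "grade_le (- int N) (formal_sum y I - (\<Sum>i\<in>I \<inter> {..<N}. y i))"
proof -
  obtain \<phi> :: "int \<Rightarrow> int" where \<phi>: "\<And>d. \<exists>n. \<phi> n \<le> d" "\<And>n Z. grade_le n Z \<Longrightarrow> lbounded (\<phi> n) Z"
    by (rule grade_le_lbounded) blast
  have tail: "\<exists>K. \<forall>i\<in>I. i \<ge> K \<longrightarrow> lbounded d (y i)" for d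
  proof -
    obtain n where n: "\<phi> n \<le> d"
      using \<phi>(1) by blast
    have "lbounded d (y i)" if "i \<in> I" "i \<ge> nat (- n)" for i
    proof -
      have "grade_le n (y i)"
        by (rule grade_le_mono[OF y[OF that(1)]]) (use that(2) in simp)
      then show ?thesis
        using \<phi>(2) n lbounded_mono by blast
    qed
    then show ?thesis by blast
  qed
  have "finite {i \<in> I. lcoeff (y i) k \<noteq> 0}" for k
  proof -
    obtain K where K: "\<forall>i\<in>I. i \<ge> K \<longrightarrow> lbounded (k - 1) (y i)"
      using tail by blast
    have "{i \<in> I. lcoeff (y i) k \<noteq> 0} \<subseteq> {..<K}"
      using K by (force simp: lbounded_def not_less[symmetric])
    then show ?thesis by (rule finite_subset) simp
  qed
  moreover have "lbounded (\<phi> 0) (y i)" if "i \<in> I" for i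
    by (rule \<phi>(2), rule grade_le_mono[OF y[OF that]]) simp
  ultimately obtain Y where "has_formal_sum y I Y"
    by (rule has_formal_sum_exists)
  then show Y: "has_formal_sum y I (formal_sum y I)"
    using formal_sum_eqI by metis
  show "grade_le (- int N) (formal_sum y I - (\<Sum>i\<in>I \<inter> {..<N}. y i))"
  proof (rule grade_le_closed)
    fix d
    obtain K where K: "\<forall>i\<in>I. i \<ge> K \<longrightarrow> lbounded d (y i)"
      using tail by blast
    \<comment> \<open>These terms of the remainder have grade at most \<open>- N\<close>; past
      \<open>K\<close> every term has order at most \<open>d\<close> in lambda.\<close>
    define Z where "Z = (\<Sum>i\<in>I \<inter> {N..<max N K}. y i)"
    have "grade_le (- int N) Z"
      unfolding Z_def by (intro grade_le_sum) (auto intro!: grade_le_mono[OF y])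
    moreover have "formal_sum y I - (\<Sum>i\<in>I \<inter> {..<N}. y i) - Z = formal_sum y I - (\<Sum>i\<in>I \<inter> {..<max N K}. y i)"
    proof -
      have "I \<inter> {..<max N K} = (I \<inter> {..<N}) \<union> (I \<inter> {N..<max N K})"
        by auto
      moreover have "sum y \<dots> = (\<Sum>i\<in>I \<inter> {..<N}. y i) + Z"
        unfolding Z_def by (rule sum.union_disjoint) auto
      ultimately show ?thesis by (simp add: algebra_simps)
    qed
    moreover have "lbounded d (formal_sum y I - (\<Sum>i\<in>I \<inter> {..<max N K}. y i))"
    proof -
      have "has_formal_sum y (I - I \<inter> {..<max N K}) (formal_sum y I - (\<Sum>i\<in>I \<inter> {..<max N K}. y i))"
        by (rule has_formal_sum_diff_finite[OF Y]) auto
      then have "lcoeff (formal_sum y I - (\<Sum>i\<in>I \<inter> {..<max N K}. y i)) k = (\<Sum>i\<in>{}. lcoeff (y i) k)" if "k > d" for k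
        by (rule has_formal_sum_lcoeff) (use K that in \<open>auto simp: lbounded_def\<close>)
      then show ?thesis by (simp add: lbounded_def)
    qed
    ultimately show "\<exists>Z. grade_le (- int N) Z \<and>
        lbounded d (formal_sum y I - (\<Sum>i\<in>I \<inter> {..<N}. y i) - Z)"
      by metis
  qed
qed

text \<open>The grade-\<open>i\<close> component of the approximants \<open>Z d\<close> is constant
  for \<open>d \<le> D i\<close>: the difference of two such components is homogeneous and of too
  low an order in lambda to be nonzero. The stable values form the expansion.\<close>

lemma grade_le_imp_grade_expansion:
  assumes "grade_le n Y"
  shows "grade_expansion \<iota> Q Y (grade_part \<iota> Q Y)" and "\<And>i. i > n \<Longrightarrow> grade_part \<iota> Q Y i = 0"
proof -
  obtain Z where Z: "\<And>d. finitely_graded n (Z d)" "\<And>d. lbounded d (Y - Z d)"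
    using assms unfolding grade_le_def by metis
  have "\<exists>z. (\<forall>i. hom i (z i)) \<and> (\<forall>i>n. z i = 0) \<and> finite {i. z i \<noteq> 0} \<and> has_formal_sum z UNIV (Z d)" for d
    using finitely_graded_components[OF Z(1)[of d]] by metis
  then obtain z where z: "\<And>d i. hom i (z d i)" "\<And>d i. i > n \<Longrightarrow> z d i = 0"
      "\<And>d. finite {i. z d i \<noteq> 0}" "\<And>d. has_formal_sum (z d) UNIV (Z d)"
    by metis
  have ZY: "lcoeff (Z d) k = lcoeff Y k" if "k > d" for d k
    using Z(2)[of d] that by (simp add: lbounded_def lcoeff_diff)
  obtain D :: "int \<Rightarrow> int" where D: "mono D" "\<And>i Y. hom i Y \<Longrightarrow> lbounded (D i) Y \<Longrightarrow> Y = 0"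
    by (rule hom_lbounded_imp_0) blast
  obtain \<phi> :: "int \<Rightarrow> int" where \<phi>: "mono \<phi>" "\<And>d. \<exists>n. \<phi> n \<le> d" "\<And>n Y. hom n Y \<Longrightarrow> lbounded (\<phi> n) Y"
    by (rule hom_lbounded) blast
  have stable: "z d i = z e i" if "d \<le> D i" "e \<le> D i" for d e i
  proof -
    have "lbounded (D i) (z d i - z e i)"
      unfolding lbounded_def
    proof (intro allI impI)
      fix k assume k: "k > D i"
      define S where "S = insert i ({i. z d i \<noteq> 0} \<union> {i. z e i \<noteq> 0})"
      have S: "finite S" using z(3) by (simp add: S_def)
      have "lcoeff (Z d) k = (\<Sum>i\<in>S. lcoeff (z d i) k)"
        by (rule has_formal_sum_lcoeff[OF z(4) S]) (auto simp: S_def)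
      moreover have "lcoeff (Z e) k = (\<Sum>i\<in>S. lcoeff (z e i) k)"
        by (rule has_formal_sum_lcoeff[OF z(4) S]) (auto simp: S_def)
      moreover have "lcoeff (Z d) k = lcoeff Y k" "lcoeff (Z e) k = lcoeff Y k"
        using ZY k that by simp_all
      ultimately have "(\<Sum>i\<in>S. lcoeff (z d i - z e i) k) = 0"
        by (simp add: lcoeff_diff sum_subtractf)
      then show "lcoeff (z d i - z e i) k = 0"
        by (rule hom_lcoeff_independent[OF S, rotated]) (auto simp: S_def intro: hom_diff z)
    qed
    then have "z d i - z e i = 0"
      by (rule D(2)[rotated]) (intro hom_diff z)
    then show ?thesis by simp
  qed
  define y where "y i = z (D i) i" for i
  have "has_formal_sum y UNIV Y"
    unfolding has_formal_sum_iff
  proof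
    fix k
    obtain i0 where i0: "\<phi> i0 \<le> k - 1"
      using \<phi>(2) by blast
    \<comment> \<open>One approximant serves all grades at lambda^k: grades up to \<open>i0\<close>
      do not reach that power, higher grades satisfy \<open>d \<le> D i\<close>, and
      \<open>d < k\<close> makes \<open>Z d\<close> agree with \<open>Y\<close> there.\<close>
    define d where "d = min (D i0) (k - 1)"
    have low: "lcoeff A k = 0" if "i \<le> i0" "hom i A" for i A
      using \<phi>(3)[OF that(2)] monoD[OF \<phi>(1) that(1)] i0 by (auto simp: lbounded_def)
    have same: "lcoeff (y i) k = lcoeff (z d i) k" for i
    proof (cases "i \<le> i0")
      case True
      then show ?thesis using low z(1) by (simp add: y_def)
    next
      case False
      then have "d \<le> D i"
        using monoD[OF D(1), of i0 i] by (simp add: d_def)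
      then show ?thesis
        using stable[of d i "D i"] by (simp add: y_def)
    qed
    have "lcoeff Y k = lcoeff (Z d) k"
      using ZY[of d k] by (simp add: d_def)
    then show "\<exists>S. finite S \<and> S \<subseteq> UNIV \<and> (\<forall>i\<in>UNIV - S. lcoeff (y i) k = 0) \<and> lcoeff Y k = (\<Sum>i\<in>S. lcoeff (y i) k)"
      using z(4)[of d] unfolding has_formal_sum_iff same by auto
  qed
  moreover have y0: "y i = 0" if "i > n" for i
    using z(2) that by (simp add: y_def)
  ultimately have exp: "grade_expansion \<iota> Q Y y"
    unfolding grade_expansion_def using z(1) by (auto simp: y_def)
  then have "grade_part \<iota> Q Y = y"
    by (rule grade_part_eqI)
  then show "grade_expansion \<iota> Q Y (grade_part \<iota> Q Y)" "\<And>i. i > n \<Longrightarrow> grade_part \<iota> Q Y i = 0"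
    using exp y0 by auto
qed

lemma grade_part_hom:
  assumes "hom i Y"
  shows "grade_part \<iota> Q Y j = (if j = i then Y else 0)"
proof -
  have "grade_expansion \<iota> Q Y (\<lambda>j. if j = i then Y else 0)"
    unfolding grade_expansion_def has_formal_sum_iff
  proof (intro conjI allI)
    show "\<exists>N. \<forall>n>N. (if n = i then Y else 0) = 0"
      by (rule exI[of _ i]) simp
    show "\<exists>S. finite S \<and> S \<subseteq> UNIV \<and> (\<forall>j\<in>UNIV - S. lcoeff (if j = i then Y else 0) k = 0)
        \<and> lcoeff Y k = (\<Sum>j\<in>S. lcoeff (if j = i then Y else 0) k)" for k
      by (rule exI[of _ "{i}"]) simp
  qed (use assms in simp)
  then show ?thesis
    by (simp add: grade_part_eqI)
qed

lemma hom_grade_part: "grade_le n Y \<Longrightarrow> hom i (grade_part \<iota> Q Y i)"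
  using grade_le_imp_grade_expansion(1) by (auto simp: grade_expansion_def)

text \<open>The grade-\<open>i\<close> component is both all of \<open>Y\<close> and zero. Thus a
  congruence modulo lower grades between elements homogeneous of grade \<open>i\<close> becomes an
  equality.\<close>

lemma hom_grade_le_imp_0: "hom i Y \<Longrightarrow> grade_le (i - 1) Y \<Longrightarrow> Y = 0"
  using grade_part_hom[of i Y i] grade_le_imp_grade_expansion(2)[of "i - 1" Y i] by simp

lemma grade_part_add:
  assumes "grade_le n A" "grade_le n B"
  shows "grade_part \<iota> Q (A + B) i = grade_part \<iota> Q A i + grade_part \<iota> Q B i"
proof -
  note a = grade_le_imp_grade_expansion[OF assms(1)] and b = grade_le_imp_grade_expansion[OF assms(2)]
  have "has_formal_sum (\<lambda>i. grade_part \<iota> Q A i + grade_part \<iota> Q B i) UNIV (A + B)"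
    unfolding has_formal_sum_iff
  proof
    fix k
    obtain S T where S: "finite S" "\<forall>i\<in>UNIV - S. lcoeff (grade_part \<iota> Q A i) k = 0"
      and T: "finite T" "\<forall>i\<in>UNIV - T. lcoeff (grade_part \<iota> Q B i) k = 0"
      using a(1) b(1) unfolding grade_expansion_def has_formal_sum_iff by meson
    have "lcoeff A k = (\<Sum>i\<in>S \<union> T. lcoeff (grade_part \<iota> Q A i) k)"
      by (rule has_formal_sum_lcoeff[of _ UNIV]) (use a(1) S T in \<open>auto simp: grade_expansion_def\<close>)
    moreover have "lcoeff B k = (\<Sum>i\<in>S \<union> T. lcoeff (grade_part \<iota> Q B i) k)"
      by (rule has_formal_sum_lcoeff[of _ UNIV]) (use b(1) S T in \<open>auto simp: grade_expansion_def\<close>)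
    ultimately show "\<exists>S. finite S \<and> S \<subseteq> UNIV \<and>
        (\<forall>i\<in>UNIV - S. lcoeff (grade_part \<iota> Q A i + grade_part \<iota> Q B i) k = 0) \<and>
        lcoeff (A + B) k = (\<Sum>i\<in>S. lcoeff (grade_part \<iota> Q A i + grade_part \<iota> Q B i) k)"
      using S T by (intro exI[of _ "S \<union> T"]) (simp add: lcoeff_add sum.distrib)
  qed
  then have "grade_expansion \<iota> Q (A + B) (\<lambda>i. grade_part \<iota> Q A i + grade_part \<iota> Q B i)"
    unfolding grade_expansion_def
    using hom_grade_part[OF assms(1)] hom_grade_part[OF assms(2)] a(2) b(2)
    by (auto intro: hom_add intro!: exI[of _ n])
  then show ?thesis
    by (simp add: grade_part_eqI)
qed

lemma grade_part_sum:
  assumes "\<And>i. i \<in> I \<Longrightarrow> grade_le n (f i)"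
  shows "grade_part \<iota> Q (sum f I) k = (\<Sum>i\<in>I. grade_part \<iota> Q (f i) k)"
  using assms
proof (induction I rule: infinite_finite_induct)
  case (insert j I)
  then show ?case
    by (simp add: grade_part_add[of n] grade_le_sum)
qed (simp_all add: grade_part_hom[of 0])

text \<open>Cutting the expansion at a grade whose order in lambda is at most \<open>d\<close>
  leaves a finite sum that approximates \<open>Y\<close> to order \<open>d\<close>.\<close>

lemma grade_le_if_expansion:
  assumes "grade_expansion \<iota> Q Y y" "\<And>i. i > m \<Longrightarrow> y i = 0"
  shows "grade_le m Y"
  unfolding grade_le_def
proof
  fix d
  obtain \<phi> :: "int \<Rightarrow> int" where \<phi>: "mono \<phi>" "\<And>d. \<exists>n. \<phi> n \<le> d" "\<And>n Y. hom n Y \<Longrightarrow> lbounded (\<phi> n) Y"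
    by (rule hom_lbounded) blast
  obtain i0 where i0: "\<phi> i0 \<le> d"
    using \<phi>(2) by blast
  have hom: "hom i (y i)" for i
    using assms(1) by (simp add: grade_expansion_def)
  have "finitely_graded m (\<Sum>i\<in>{i0..m}. y i)"
    by (rule finitely_graded_sum) (auto intro: finitely_graded_hom hom)
  moreover have "lbounded d (Y - (\<Sum>i\<in>{i0..m}. y i))"
    unfolding lbounded_def
  proof (intro allI impI)
    fix k assume k: "k > d"
    have "has_formal_sum y (UNIV - {i0..m}) (Y - sum y {i0..m})"
      by (rule has_formal_sum_diff_finite) (use assms(1) in \<open>auto simp: grade_expansion_def\<close>)
    then have "lcoeff (Y - sum y {i0..m}) k = (\<Sum>i\<in>{}. lcoeff (y i) k)"
    proof (rule has_formal_sum_lcoeff)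
      fix i assume "i \<in> UNIV - {i0..m} - {}"
      then consider "i > m" | "i \<le> i0" by force
      then show "lcoeff (y i) k = 0"
      proof cases
        case 2
        then show ?thesis
          using \<phi>(3)[OF hom[of i]] monoD[OF \<phi>(1), of i i0] i0 k by (simp add: lbounded_def)
      qed (simp add: assms(2))
    qed auto
    then show "lcoeff (Y - sum y {i0..m}) k = 0" by simp
  qed
  ultimately show "\<exists>Z. finitely_graded m Z \<and> lbounded d (Y - Z)"
    by blast
qed

text \<open>Components above \<open>n\<close> vanish, so subtracting a finite range isolates all
  grades below \<open>N\<close>. This form of the projection serves both the negative part and the
  trace.\<close>

lemma grade_tail:
  fixes N :: int
  assumes "grade_le n Y"
  defines "R \<equiv> Y - (\<Sum>i=N..n. grade_part \<iota> Q Y i)"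
  shows "has_formal_sum (grade_part \<iota> Q Y) {..<N} R" and "grade_le (N - 1) R"
proof -
  let ?y = "grade_part \<iota> Q Y"
  note y = grade_le_imp_grade_expansion[OF assms(1)]
  have "has_formal_sum ?y (UNIV - {N..n}) R"
    unfolding R_def
    by (rule has_formal_sum_diff_finite) (use y(1) in \<open>auto simp: grade_expansion_def\<close>)
  moreover have "{i \<in> UNIV - {N..n}. lcoeff (?y i) k \<noteq> 0} = {i \<in> {..<N}. lcoeff (?y i) k \<noteq> 0}" for k
    using y(2) by (force simp: not_le)
  ultimately show R: "has_formal_sum ?y {..<N} R"
    by (simp add: has_formal_sum_def)
  have "{i \<in> UNIV. lcoeff (if i < N then ?y i else 0) k \<noteq> 0} = {i \<in> {..<N}. lcoeff (?y i) k \<noteq> 0}" for k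
    by auto
  then have "has_formal_sum (\<lambda>i. if i < N then ?y i else 0) UNIV R"
    using R by (simp add: has_formal_sum_def cong: sum.cong_simp)
  then have "grade_expansion \<iota> Q R (\<lambda>i. if i < N then ?y i else 0)"
    unfolding grade_expansion_def using hom_grade_part[OF assms(1)] by (auto intro!: exI[of _ N])
  then show "grade_le (N - 1) R"
    by (rule grade_le_if_expansion) auto
qed

lemma neg_part:
  assumes "grade_le n Y"
  shows "grade_le (- 1) (neg_part \<iota> Q Y)"
    and "grade_le (- 2) (neg_part \<iota> Q Y - grade_part \<iota> Q Y (- 1))"
proof -
  \<comment> \<open>With the bound raised to at least 0, \<open>{-1..max n 0}\<close> exceeds
    \<open>{0..max n 0}\<close> by exactly \<open>-1\<close>, even if \<open>n < -1\<close>.\<close>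
  have Y: "grade_le (max n 0) Y"
    by (rule grade_le_mono[OF assms]) simp
  have eq: "neg_part \<iota> Q Y = Y - (\<Sum>i=0..max n 0. grade_part \<iota> Q Y i)"
    unfolding neg_part_def by (rule formal_sum_eqI[OF grade_tail(1)[OF Y]])
  show "grade_le (- 1) (neg_part \<iota> Q Y)"
    unfolding eq using grade_tail(2)[OF Y, of 0] by simp
  have "{-1..max n 0} = insert (-1) {0..max n 0}"
    by auto
  then show "grade_le (- 2) (neg_part \<iota> Q Y - grade_part \<iota> Q Y (- 1))"
    unfolding eq using grade_tail(2)[OF Y, of "-1"] by (simp add: algebra_simps)
qed

section \<open>The trace\<close>

lemma Tr_add:
  "grade_le n A \<Longrightarrow> grade_le n B \<Longrightarrow> Tr \<iota> Q (A + B) = Tr \<iota> Q A + Tr \<iota> Q B"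
  by (simp add: Tr_def grade_part_add trace_add)

lemma Tr_hom: "hom 0 A \<Longrightarrow> Tr \<iota> Q A = fls_nth (trace A) 0"
  by (simp add: Tr_def grade_part_hom)

lemma Tr_grade_le: "grade_le (- 1) A \<Longrightarrow> Tr \<iota> Q A = 0"
  using grade_le_imp_grade_expansion(2)[of "-1" A 0] by (simp add: Tr_def trace_def)

text \<open>Components of \<open>Y\<close> above grade \<open>- j\<close> give products of positive
  grade, and the tail below gives a product of grade at most -1; the projection on grade zero
  removes both.\<close>

lemma Tr_mult_hom:
  assumes A: "hom j A" and Y: "grade_le n Y"
  shows "Tr \<iota> Q (A ** Y) = fls_nth (trace (A ** grade_part \<iota> Q Y (- j))) 0"
proof -
  let ?y = "grade_part \<iota> Q Y"
  \<comment> \<open>The maximum keeps \<open>- j\<close> in the summation range even when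
    \<open>n < - j\<close>.\<close>
  define N where "N = max n (- j)"
  have Y': "grade_le N Y"
    by (rule grade_le_mono[OF Y]) (simp add: N_def)
  have hom: "hom (j + i) (A ** ?y i)" for i
    by (rule hom_mult[OF A hom_grade_part[OF Y]])
  define R where "R = Y - (\<Sum>i=-j..N. ?y i)"
  have "grade_le (- j - 1) R"
    unfolding R_def by (rule grade_tail(2)[OF Y'])
  from grade_le_mult[OF grade_le_hom[OF A order.refl] this]
  have R: "grade_le (- 1) (A ** R)" by simp
  have P: "grade_le (j + N) (\<Sum>i=-j..N. A ** ?y i)"
    by (rule grade_le_sum) (auto intro: grade_le_hom[OF hom])
  have "A ** Y = (\<Sum>i=-j..N. A ** ?y i) + A ** R"
    by (simp add: R_def matrix_dists matrix_sum_ldist)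
  then have "Tr \<iota> Q (A ** Y) = Tr \<iota> Q (\<Sum>i=-j..N. A ** ?y i)"
    using Tr_add[OF P grade_le_mono[OF R]] Tr_grade_le[OF R] by (simp add: N_def)
  moreover have "grade_part \<iota> Q (\<Sum>i=-j..N. A ** ?y i) 0 = A ** ?y (- j)"
  proof -
    have "grade_part \<iota> Q (\<Sum>i=-j..N. A ** ?y i) 0 = (\<Sum>i=-j..N. grade_part \<iota> Q (A ** ?y i) 0)"
      by (rule grade_part_sum[of _ "j + N"]) (auto intro: grade_le_hom[OF hom])
    also have "\<dots> = (\<Sum>i=-j..N. if i = - j then A ** ?y (- j) else 0)"
      by (intro sum.cong) (auto simp: grade_part_hom[OF hom])
    also have "\<dots> = A ** ?y (- j)"
      by (simp add: N_def)
    finally show ?thesis .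
  qed
  ultimately show ?thesis
    by (simp add: Tr_def)
qed

section \<open>Constant elements and derivations\<close>

lemma cemb_nth [simp]: "fls_nth (cemb \<iota> Y $ i $ j) k = \<iota> (fls_nth (Y $ i $ j) k)"
  by (simp add: cemb_def)

lemma lcoeff_cemb [simp]: "lcoeff (cemb \<iota> Y) k = map_matrix \<iota> (lcoeff Y k)"
  by (simp add: vec_eq_iff)

lemma cemb_mult: "cemb \<iota> (A ** B) = cemb \<iota> A ** cemb \<iota> B"
  by (simp add: vec_eq_iff fls_eq_iff)
    (simp add: cemb_def matrix_matrix_mult_def fls_nth_sum emb_sum fls_map_mult[OF emb_add emb_mult, symmetric])

lemma cemb_diff: "cemb \<iota> (A - B) = cemb \<iota> A - cemb \<iota> B"
  by (simp add: vec_eq_iff fls_eq_iff emb_diff)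

lemma map_matrix_mcomm: "map_matrix \<iota> (mcomm A B) = mcomm (map_matrix \<iota> A) (map_matrix \<iota> B)"
  by (simp add: mcomm_def vec_eq_iff matrix_matrix_mult_def emb_diff emb_sum emb_mult)

lemma cemb_mcomm: "cemb \<iota> (mcomm A B) = mcomm (cemb \<iota> A) (cemb \<iota> B)"
  by (simp add: mcomm_def cemb_mult cemb_diff)

lemma hom_cemb:
  assumes "homogeneous id Q n Y"
  shows "hom n (cemb \<iota> Y)"
proof -
  \<comment> \<open>Over the complex numbers the embedding is \<open>id\<close>, and the eigenvalue
    criterion holds with the same weights.\<close>
  interpret complex: grading id Q
    by unfold_locales (simp_all add: constants_embedding_def scale_pos)
  have id: "map_matrix id (snd Q) = snd Q"
    by (simp add: vec_eq_iff)
  have "mcomm (snd Q) (lcoeff Y k) = smul (weight n k) (lcoeff Y k)" for k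
    using assms unfolding complex.hom_iff by (simp add: id)
  then have "mcomm H (map_matrix \<iota> (lcoeff Y k)) = map_matrix \<iota> (smul (weight n k) (lcoeff Y k))" for k
    by (metis map_matrix_mcomm)
  then show ?thesis
    unfolding hom_iff by (simp add: vec_eq_iff emb_mult)
qed

lemma hom_fun_span:
  assumes "V \<subseteq> grade_space Q G n" "Y \<in> fun_span \<iota> V"
  shows "hom n Y"
proof -
  obtain T f where "T \<subseteq> V" and Y: "Y = (\<Sum>v\<in>T. smul (fls_const (f v)) (cemb \<iota> v))"
    using assms(2) unfolding fun_span_def by blast
  then have "homogeneous id Q n v" if "v \<in> T" for v
    using assms(1) that by (auto simp: grade_space_def)
  then show ?thesis
    unfolding Y by (intro hom_sum hom_smul hom_cemb)
qed

lemma trace_mult_ad_im: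
  assumes "V \<subseteq> ad_im G E" "Y \<in> fun_span \<iota> V"
  shows "trace (cemb \<iota> E ** Y) = 0"
proof -
  obtain T f where T: "T \<subseteq> V" and Y: "Y = (\<Sum>v\<in>T. smul (fls_const (f v)) (cemb \<iota> v))"
    using assms(2) unfolding fun_span_def by blast
  have "trace (cemb \<iota> E ** cemb \<iota> v) = 0" if v: "v \<in> T" for v
  proof -
    obtain w where "v = mcomm E w"
      using v T assms(1) by (auto simp: ad_im_def)
    then show ?thesis
      by (simp add: cemb_mcomm trace_mult_mcomm)
  qed
  then show ?thesis
    by (simp add: Y matrix_sum_ldist smul_mult_right trace_sum trace_smul)
qed

context
  fixes d assumes d: "derivation \<iota> d"
begin

lemma d_add: "d (a + b) = d a + d b" and d_mult: "d (a * b) = d a * b + a * d b"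
  and d_emb: "d (\<iota> z) = 0"
  using d by (auto simp: derivation_def)

lemma d_0 [simp]: "d 0 = 0"
  using d_emb[of 0] by simp

lemma d_1 [simp]: "d 1 = 0"
  using d_emb[of 1] by simp

lemma d_sum: "d (sum f I) = (\<Sum>i\<in>I. d (f i))"
  by (induction I rule: infinite_finite_induct) (simp_all add: d_add)

lemma d_minus: "d (- a) = - d a"
  using d_add[of a "- a"] by (simp add: minus_unique)

lemma mderiv_nth [simp]: "fls_nth (mderiv d Y $ i $ j) k = d (fls_nth (Y $ i $ j) k)"
  by (simp add: mderiv_def)

lemma lcoeff_mderiv: "lcoeff (mderiv d Y) k = map_matrix d (lcoeff Y k)"
  by (simp add: vec_eq_iff)

lemma mderiv_add: "mderiv d (A + B) = mderiv d A + mderiv d B"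
  by (simp add: vec_eq_iff fls_eq_iff d_add)

lemma mderiv_mult: "mderiv d (A ** B) = mderiv d A ** B + A ** mderiv d B"
proof -
  have "fls_nth ((mderiv d (A ** B)) $ i $ j) k = (\<Sum>l\<in>UNIV. fls_nth (fls_map d (A $ i $ l * B $ l $ j)) k)" for i j k
    by (simp add: matrix_matrix_mult_def fls_nth_sum d_sum)
  then show ?thesis
    by (simp add: vec_eq_iff fls_eq_iff fls_map_derivation[OF d_add d_mult] del: mderiv_nth)
      (simp add: mderiv_def matrix_matrix_mult_def fls_nth_sum sum.distrib)
qed

lemma mderiv_cemb [simp]: "mderiv d (cemb \<iota> Y) = 0"
  by (simp add: vec_eq_iff fls_eq_iff d_emb)

lemma mderiv_1 [simp]: "mderiv d (mat 1) = 0"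
  by (simp add: vec_eq_iff fls_eq_iff mat_def)

lemma trace_mderiv: "fls_nth (trace (mderiv d Y)) k = d (fls_nth (trace Y) k)"
  by (simp add: trace_def fls_nth_sum d_sum)

text \<open>The entries of \<open>H\<close> and the weights are constants, so a derivation that
  kills constants commutes with ad H and with the weights on every coefficient.\<close>

lemma hom_mderiv:
  assumes "hom n Y"
  shows "hom n (mderiv d Y)"
proof -
  have c: "d (\<iota> z * a) = \<iota> z * d a" "d (a * \<iota> z) = d a * \<iota> z" for z a
    by (simp_all add: d_mult d_emb)
  have "d (x - y) = d x - d y" for x y
    using d_add[of x "- y"] by (simp add: d_minus)
  then have "mcomm H (map_matrix d a) = map_matrix d (mcomm H a)" for a
    by (simp add: mcomm_def vec_eq_iff matrix_matrix_mult_def c d_sum)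
  moreover have "smul (\<iota> z) (map_matrix d a) = map_matrix d (smul (\<iota> z) a)" for z a
    by (simp add: vec_eq_iff c)
  ultimately show ?thesis
    using assms unfolding hom_iff lcoeff_mderiv by metis
qed

lemma grade_le_mderiv: "grade_le n Y \<Longrightarrow> grade_le n (mderiv d Y)"
proof (erule grade_le_map)
  have "lbounded e (mderiv d A)" if "lbounded e A" for e A
    using that by (simp add: lbounded_def lcoeff_mderiv) (simp add: vec_eq_iff)
  then show "\<exists>e. \<forall>A. lbounded e A \<longrightarrow> lbounded e' (mderiv d A)" for e'
    by blast
qed (auto simp: mderiv_add intro: finitely_graded_hom[OF hom_mderiv])

end

section \<open>Dressing operators\<close>

lemma mpow_Suc: "mpow A (Suc k) = A ** mpow A k"
  by (simp add: mpow_def)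

lemma mpow_0 [simp]: "mpow A 0 = mat 1"
  by (simp add: mpow_def)

lemma mpow_commute: "mpow A k ** A = A ** mpow A k"
  by (induction k) (simp_all add: mpow_Suc matrix_mul_assoc[symmetric])

lemma grade_le_1 [simp]: "grade_le 0 (mat 1)"
  by (rule grade_le_hom[OF hom_1]) simp

lemma grade_le_mpow:
  assumes "grade_le (- 1) W"
  shows "grade_le (- int k) (mpow W k)"
proof (induction k)
  case (Suc k)
  then show ?case
    using grade_le_mult[OF assms Suc] by (simp add: mpow_Suc algebra_simps)
qed simp

text \<open>The \<open>k\<close>-th term of the exponential has grade at most \<open>- k\<close>, so
  the terms with \<open>k = 0\<close> and \<open>k = 1\<close> are the only ones to remove.\<close>

lemma mexp_expansion:
  assumes "grade_le (- 1) W"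
  shows "grade_le (- 2) (mexp \<iota> W - mat 1 - W)"
proof -
  have "grade_le (- int 2) (mexp \<iota> W - (\<Sum>i\<in>UNIV \<inter> {..<2}. smul (fls_const (\<iota> (1 / fact i))) (mpow W i)))"
    unfolding mexp_def
    by (rule grade_le_formal_sum(2)) (intro grade_le_smul grade_le_mpow assms)
  moreover have "UNIV \<inter> {..<2} = {0, 1::nat}"
    by auto
  ultimately show ?thesis
    using mpow_Suc[of W 0] by (simp add: diff_diff_eq)
qed

text \<open>Neumann series in \<open>N = mat 1 - \<Theta>\<close>: the partial sums telescope, so on
  either side the defect has grade at most \<open>- k\<close> for every \<open>k\<close> and
  vanishes.\<close>

lemma unipotent_inverse:
  assumes "grade_le (- 1) (\<Theta> - mat 1)"
  shows "\<Theta> ** matrix_inv \<Theta> = mat 1" "matrix_inv \<Theta> ** \<Theta> = mat 1" "grade_le 0 (matrix_inv \<Theta>)"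
proof -
  define N where "N = mat 1 - \<Theta>"
  have N: "grade_le (- 1) N"
    using grade_le_diff[OF grade_le_0 assms] by (simp add: N_def)
  define P where "P = formal_sum (mpow N) UNIV"
  have P: "grade_le (- int k) (P - (\<Sum>i<k. mpow N i))" for k
    using grade_le_formal_sum(2)[of UNIV "mpow N" k] grade_le_mpow[OF N] by (simp add: P_def)
  have \<Theta>: "grade_le 0 \<Theta>"
    using grade_le_add[OF grade_le_mono[OF assms] grade_le_1] by simp
  have \<Theta>N: "\<Theta> = mat 1 - N"
    by (simp add: N_def)
  have powers: "mpow N k ** \<Theta> = mpow N k - mpow N (Suc k)" "\<Theta> ** mpow N k = mpow N k - mpow N (Suc k)" for k
    by (simp_all add: \<Theta>N matrix_dists mpow_Suc mpow_commute)
  have geometric: "\<Theta> ** (\<Sum>i<k. mpow N i) = mat 1 - mpow N k"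
    "(\<Sum>i<k. mpow N i) ** \<Theta> = mat 1 - mpow N k" for k
    by (induction k) (simp_all add: powers matrix_dists)
  have "\<Theta> ** P - mat 1 = 0"
  proof (rule grade_le_all_imp_0)
    fix k
    have "\<Theta> ** P - mat 1 = \<Theta> ** (P - (\<Sum>i<k. mpow N i)) - mpow N k"
      using geometric(1)[of k] by (simp add: matrix_dists)
    then show "grade_le (- int k) (\<Theta> ** P - mat 1)"
      using grade_le_diff[OF grade_le_mult[OF \<Theta> P[of k], simplified] grade_le_mpow[OF N]] by simp
  qed
  moreover have "P ** \<Theta> - mat 1 = 0"
  proof (rule grade_le_all_imp_0)
    fix k
    have "P ** \<Theta> - mat 1 = (P - (\<Sum>i<k. mpow N i)) ** \<Theta> - mpow N k"
      using geometric(2)[of k] by (simp add: matrix_dists)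
    then show "grade_le (- int k) (P ** \<Theta> - mat 1)"
      using grade_le_diff[OF grade_le_mult[OF P[of k] \<Theta>, simplified] grade_le_mpow[OF N]] by simp
  qed
  ultimately have inv: "\<Theta> ** P = mat 1" "P ** \<Theta> = mat 1"
    by simp_all
  then have "matrix_inv \<Theta> = P"
    by (rule matrix_inv_unique)
  then show "\<Theta> ** matrix_inv \<Theta> = mat 1" "matrix_inv \<Theta> ** \<Theta> = mat 1" "grade_le 0 (matrix_inv \<Theta>)"
    using inv P[of 0] by simp_all
qed

text \<open>The cross term is \<open>(A - mat 1) ** (B - mat 1)\<close>, of grade at most -2. Hence
  the leading terms add, whether or not they commute.\<close>

lemma unipotent_mult:
  assumes A: "grade_le (- 2) (A - mat 1 - a)" "grade_le (- 1) a"
    and B: "grade_le (- 2) (B - mat 1 - b)" "grade_le (- 1) b"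
  shows "grade_le (- 2) (A ** B - mat 1 - (a + b))"
proof -
  have A1: "grade_le (- 1) (A - mat 1)"
    using grade_le_add[OF grade_le_mono[OF A(1), of "-1"] A(2)] by simp
  have B1: "grade_le (- 1) (B - mat 1)"
    using grade_le_add[OF grade_le_mono[OF B(1), of "-1"] B(2)] by simp
  have "A ** B - mat 1 - (a + b) = (A - mat 1 - a) + (B - mat 1 - b) + (A - mat 1) ** (B - mat 1)"
    by (simp add: matrix_dists)
  moreover have "grade_le (- 2) \<dots>"
    using grade_le_mult[OF A1 B1] by (intro grade_le_add A(1) B(1)) simp
  ultimately show ?thesis
    by (simp only:)
qed

text \<open>Modulo grade at most -2 the two sides of the flow equation reduce to
  \<open>mderiv d \<theta>\<close> and to the component \<open>w\<close>. Both are homogeneous of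
  grade -1, hence equal, and constancy of \<open>E\<close> lets the derivation pass outside the
  trace.\<close>

lemma Tr_flow:
  assumes E: "hom 1 (cemb \<iota> E)" and X: "hom m (cemb \<iota> X)"
    and d: "derivation \<iota> d"
    and \<theta>: "hom (- 1) \<theta>" "grade_le (- 2) (\<Theta> - mat 1 - \<theta>)"
    and flow: "mderiv d \<Theta> = neg_part \<iota> Q (\<Theta> ** cemb \<iota> X ** matrix_inv \<Theta>) ** \<Theta>"
  shows "Tr \<iota> Q (cemb \<iota> E ** (\<Theta> ** cemb \<iota> X ** matrix_inv \<Theta>)) = d (fls_nth (trace (cemb \<iota> E ** \<theta>)) 0)"
proof -
  define W where "W = \<Theta> ** cemb \<iota> X ** matrix_inv \<Theta>"
  define w where "w = grade_part \<iota> Q W (- 1)"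
  have \<Theta>1: "grade_le (- 1) (\<Theta> - mat 1)"
    using grade_le_add[OF grade_le_mono[OF \<theta>(2), of "-1"] grade_le_hom[OF \<theta>(1)]] by simp
  have \<Theta>: "grade_le 0 \<Theta>"
    using grade_le_add[OF grade_le_mono[OF \<Theta>1] grade_le_1] by simp
  have W: "grade_le m W"
    using grade_le_mult[OF grade_le_mult[OF \<Theta> grade_le_hom[OF X order.refl]] unipotent_inverse(3)[OF \<Theta>1]]
    by (simp add: W_def)
  have w: "hom (- 1) w"
    unfolding w_def by (rule hom_grade_part[OF W])
  \<comment> \<open>The three corrections: the rest of the negative part, its product with the
    non-identity part of \<open>\<Theta>\<close>, and the derivative of what
    \<open>mat 1 + \<theta>\<close> omits.\<close>
  define R where "R = (neg_part \<iota> Q W - w) + neg_part \<iota> Q W ** (\<Theta> - mat 1) - mderiv d (\<Theta> - mat 1 - \<theta>)"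
  have "grade_le (- 2) R"
    unfolding R_def w_def
    using grade_le_mult[OF neg_part(1)[OF W] \<Theta>1]
    by (intro grade_le_diff grade_le_add neg_part(2)[OF W] grade_le_mderiv[OF d \<theta>(2)]) simp
  moreover have "mderiv d \<theta> - w = R"
  proof -
    have "mderiv d \<Theta> = mderiv d (\<Theta> - mat 1 - \<theta>) + mderiv d \<theta> + mderiv d (mat 1)"
      by (simp flip: mderiv_add[OF d])
    then have "mderiv d \<theta> = neg_part \<iota> Q W ** \<Theta> - mderiv d (\<Theta> - mat 1 - \<theta>)"
      using flow by (simp add: W_def mderiv_1[OF d])
    then show ?thesis
      by (simp add: R_def matrix_dists)
  qed
  ultimately have "mderiv d \<theta> - w = 0"
    using hom_grade_le_imp_0[OF hom_diff[OF hom_mderiv[OF d \<theta>(1)] w]] by simp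
  then have "w = mderiv d \<theta>"
    by simp
  moreover have "Tr \<iota> Q (cemb \<iota> E ** W) = fls_nth (trace (cemb \<iota> E ** w)) 0"
    unfolding w_def by (rule Tr_mult_hom[OF E W])
  moreover have "cemb \<iota> E ** mderiv d \<theta> = mderiv d (cemb \<iota> E ** \<theta>)"
    by (simp add: mderiv_mult[OF d] mderiv_cemb[OF d])
  ultimately show ?thesis
    by (simp add: W_def trace_mderiv[OF d])
qed

end

section \<open>The potential of the cocycle\<close>

theorem mainTheorem5:
  fixes G :: "(complex, 'n::finite) loop_mat set"
    and Q :: "'n grading_op"
    and E :: "(complex, 'n) loop_mat"
    and \<iota> :: "complex \<Rightarrow> 'f::comm_ring_1"
    and dx :: "'f \<Rightarrow> 'f"
    and \<delta> :: "(complex, 'n) loop_mat \<Rightarrow> 'f \<Rightarrow> 'f"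
    and A U S \<Theta> \<ss> :: "('f, 'n) loop_mat"
    and u s :: "nat \<Rightarrow> ('f, 'n) loop_mat"
  assumes affine: "affine_lie_algebra G"
    and grad: "integral_gradation Q G"
    and E1: "E \<in> grade_space Q G 1"
    and semisimple: "semisimple_loop E" "ker_im_decomposition G E"
    and constants: "constants_embedding \<iota>"
    and dx: "derivation \<iota> dx"
    and \<delta>: "\<And>m X. m \<ge> 0 \<Longrightarrow> X \<in> K_space Q G E m \<Longrightarrow> derivation \<iota> (\<delta> X)"
    and A: "A \<in> fun_span \<iota> (M_space Q G E 0)"
    and u: "\<And>j. j \<ge> 1 \<Longrightarrow> u j \<in> fun_span \<iota> (M_space Q G E (- int j))"
    and s: "\<And>j. j \<ge> 1 \<Longrightarrow> s j \<in> fun_span \<iota> (K_space Q G E (- int j))"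
    and U: "U = mexp \<iota> (formal_sum u {1..})"
    and \<ss>: "\<ss> = formal_sum s {1..}"
    and S: "S = mexp \<iota> \<ss>"
    and \<Theta>: "\<Theta> = U ** S"
    and dress_U: "\<exists>\<kappa> Kminus. (\<forall>n<0. \<kappa> n \<in> fun_span \<iota> (K_space Q G E n)) \<and> has_formal_sum \<kappa> {..<0} Kminus \<and>
          dress U (lax_op dx (cemb \<iota> E + A)) = lax_op dx (cemb \<iota> E + Kminus)"
    and dress_\<Theta>: "dress \<Theta> (lax_op dx (cemb \<iota> E + A)) = lax_op dx (cemb \<iota> E)"
    and flow: "\<And>m X. m \<ge> 0 \<Longrightarrow> X \<in> K_space Q G E m \<Longrightarrow>
          mderiv (\<delta> X) \<Theta> = neg_part \<iota> Q (\<Theta> ** cemb \<iota> X ** matrix_inv \<Theta>) ** \<Theta>"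
  shows "exact_cocycle (\<Union>m\<in>{0..}. K_space Q G E m) \<delta> (Omega \<iota> Q E \<Theta>) \<and>
    (\<forall>m\<ge>0. \<forall>X\<in>K_space Q G E m.
       Omega \<iota> Q E \<Theta> X = - \<delta> X (Tr \<iota> Q (cemb \<iota> E ** \<ss>)) \<and>
       - \<delta> X (Tr \<iota> Q (cemb \<iota> E ** \<ss>)) = - \<delta> X (Tr \<iota> Q (cemb \<iota> E ** s 1)))"
proof -
  interpret grading \<iota> Q
    using constants grad by unfold_locales (simp_all add: integral_gradation_def)
  have hom_u: "hom (- int j) (u j)" if "j \<ge> 1" for j
    by (rule hom_fun_span[OF _ u[OF that]]) (auto simp: M_space_def)
  have hom_s: "hom (- int j) (s j)" if "j \<ge> 1" for j
    by (rule hom_fun_span[OF _ s[OF that]]) (auto simp: K_space_def)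
  have hom_E: "hom 1 (cemb \<iota> E)"
    using E1 by (intro hom_cemb) (simp add: grade_space_def)
  have leading: "grade_le (- 1) (formal_sum y {1..})" "grade_le (- 2) (formal_sum y {1..} - y 1)"
    if "\<And>j. j \<ge> 1 \<Longrightarrow> hom (- int j) (y j)" for y :: "nat \<Rightarrow> ('f, 'n) loop_mat"
  proof -
    have y: "grade_le (- int j) (y j)" if "j \<in> {1..}" for j
      by (rule grade_le_hom) (use \<open>\<And>j. j \<ge> 1 \<Longrightarrow> hom (- int j) (y j)\<close> that in auto)
    \<comment> \<open>The sums start at index 1, so truncation at 1 removes nothing and truncation
      at 2 removes only \<open>y 1\<close>.\<close>
    have I: "{Suc 0..} \<inter> {..<Suc 0} = {}" "{Suc 0..} \<inter> {..<2} = {Suc 0}"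
      by auto
    show "grade_le (- 1) (formal_sum y {1..})"
      using grade_le_formal_sum(2)[OF y, of "{1..}" 1] by (simp add: I)
    show "grade_le (- 2) (formal_sum y {1..} - y 1)"
      using grade_le_formal_sum(2)[OF y, of "{1..}" 2] by (simp add: I)
  qed
  have exp: "grade_le (- 2) (mexp \<iota> (formal_sum y {1..}) - mat 1 - y 1)"
    if y: "\<And>j. j \<ge> 1 \<Longrightarrow> hom (- int j) (y j)" for y :: "nat \<Rightarrow> ('f, 'n) loop_mat"
  proof -
    have "mexp \<iota> (formal_sum y {1..}) - mat 1 - y 1
        = (mexp \<iota> (formal_sum y {1..}) - mat 1 - formal_sum y {1..}) + (formal_sum y {1..} - y 1)"
      by simp
    then show ?thesis
      using grade_le_add[OF mexp_expansion[OF leading(1)[OF y]] leading(2)[OF y]] by (simp only:)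
  qed
  have hom_u1: "hom (- 1) (u 1)" and hom_s1: "hom (- 1) (s 1)"
    using hom_u[of 1] hom_s[of 1] by simp_all
  have \<theta>: "grade_le (- 2) (\<Theta> - mat 1 - (u 1 + s 1))"
    unfolding \<Theta> U S \<ss>
    by (intro unipotent_mult exp hom_u hom_s grade_le_hom[OF hom_u1] grade_le_hom[OF hom_s1]) auto
  have "trace (cemb \<iota> E ** u 1) = 0"
    by (rule trace_mult_ad_im[OF _ u]) (auto simp: M_space_def)
  moreover have "hom 0 (cemb \<iota> E ** s 1)"
    using hom_mult[OF hom_E hom_s1] by simp
  ultimately have Tr_E: "fls_nth (trace (cemb \<iota> E ** (u 1 + s 1))) 0 = Tr \<iota> Q (cemb \<iota> E ** s 1)"
    by (simp add: matrix_dists trace_add Tr_hom)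
  \<comment> \<open>Past \<open>s 1\<close> the sum has grade at most -2, and multiplication by
    \<open>E\<close> raises this to at most -1, still below the grade seen by the trace.\<close>
  have "grade_le (1 + - 2) (cemb \<iota> E ** (\<ss> - s 1))"
    unfolding \<ss> by (intro grade_le_mult grade_le_hom[OF hom_E] leading(2) hom_s) auto
  then have "Tr \<iota> Q (cemb \<iota> E ** (\<ss> - s 1)) = 0" "grade_le 0 (cemb \<iota> E ** (\<ss> - s 1))"
    by (auto intro: Tr_grade_le grade_le_mono)
  moreover have "grade_le 0 (cemb \<iota> E ** s 1)"
    by (rule grade_le_hom[OF \<open>hom 0 (cemb \<iota> E ** s 1)\<close>]) simp
  ultimately have Tr_s: "Tr \<iota> Q (cemb \<iota> E ** \<ss>) = Tr \<iota> Q (cemb \<iota> E ** s 1)"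
    using Tr_add[of 0 "cemb \<iota> E ** (\<ss> - s 1)" "cemb \<iota> E ** s 1"] by (simp flip: matrix_add_ldistrib)
  have \<Omega>: "Omega \<iota> Q E \<Theta> X = - \<delta> X (Tr \<iota> Q (cemb \<iota> E ** s 1))"
    if "m \<ge> 0" "X \<in> K_space Q G E m" for m X
  proof -
    have "hom m (cemb \<iota> X)"
      using that(2) by (intro hom_cemb) (simp add: K_space_def grade_space_def)
    then show ?thesis
      using Tr_flow[OF hom_E _ \<delta>[OF that] hom_add[OF hom_u1 hom_s1] \<theta> flow[OF that]]
      unfolding Omega_def Tr_E by (simp only:)
  qed
  have "exact_cocycle (\<Union>m\<in>{0..}. K_space Q G E m) \<delta> (Omega \<iota> Q E \<Theta>)"
    unfolding exact_cocycle_def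
  \<comment> \<open>The sign moves inside because each flow is additive; the resulting function is
    the same for all \<open>X\<close>.\<close>
  proof (intro exI[of _ "- Tr \<iota> Q (cemb \<iota> E ** s 1)"] ballI)
    fix X assume "X \<in> (\<Union>m\<in>{0..}. K_space Q G E m)"
    then obtain m where m: "m \<ge> 0" "X \<in> K_space Q G E m" by auto
    then show "Omega \<iota> Q E \<Theta> X = \<delta> X (- Tr \<iota> Q (cemb \<iota> E ** s 1))"
      using \<Omega>[OF m] d_minus[OF \<delta>[OF m]] by simp
  qed
  then show ?thesis
    using \<Omega> Tr_s by simp
qed

end
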